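(* Let $p\ge0$ be an integer, and let $A\in\mathcal F$, $g$ and the solution $u:[0,T]\to X$ of $u'+Au=g(u)$, $u(0)=u_0$, be as in the setting. Then $$u(\zeta h)=e^{-\zeta hA}u_0+B_p(u_0)(\zeta)+\mathcal O(h^{p+1}),\qquad \zeta\in[0,1],$$ where $$B_p(w)(\zeta)=\sum_{\tau\in\mathcal T_p}\frac{h^{\varrho(\tau)}}{\sigma(\tau)}\,G_\zeta(\tau)(w).$$ Here $\mathcal O(h^{p+1})$ denotes a term bounded in norm by $Ch^{p+1}$ for all $0<h\le h_0$ and $\zeta\in[0,1]$, with $C,h_0>0$ not depending on $A$ itself, but only on $C_{\mathcal F}$, $p$, $T$, $r$ and the bounds on $g$ and its derivatives.
   Context: Setting. $X$ is a Banach space with norm $\|\cdot\|$. $\mathcal F$ is a family of linear operators on $X$ and $C_{\mathcal F}$ a constant such that for every $A\in\mathcal F$ the operator $-A$ generates a strongly continuous group with $\|e^{-tA}\|\le C_{\mathcal F}$ for all $t\in\mathbb R$, or only a strongly continuous semigroup with this bound for all $t\ge0$. The function $u:[0,T]\to X$ is the solution in the sense $u(t)=e^{-tA}u_0+\int_0^t e^{-(t-s)A}g(u(s))\,ds$. The nonlinearity $g$ is $p$ times Fréchet differentiable (over $\mathbb R$) on a neighbourhood $U=\{v\in X:\|v-u(t)\|<r\text{ for some }t\in[0,T]\}$ with $g,g',\dots,g^{(p)}$ bounded on $U$. Trees. $\mathcal T$ is the set of unlabeled rooted trees: $\bullet\in\mathcal T$ (single node), and $[\tau_1,\dots,\tau_k]\in\mathcal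 T$ if $\tau_1,\dots,\tau_k\in\mathcal T$ (the roots of the $\tau_j$ are joined by branches to a new root; the order of the $\tau_j$ is irrelevant). $\varrho(\tau)$ is the number of nodes, $\mathcal T_p=\{\tau\in\mathcal T:\varrho(\tau)\le p\}$ (so $\mathcal T_0=\emptyset$ and $B_0=0$). Symmetry coefficients: $\sigma(\bullet)=1$, $\sigma([\tau_1,\dots,\tau_k])=\sigma(\tau_1)\cdots\sigma(\tau_k)\,\mu_1!\mu_2!\cdots$, where $\mu_1,\mu_2,\dots$ are the numbers of equal trees among $\tau_1,\dots,\tau_k$. Elementary integrals. Write $g_\eta^{(k)}(w)=g^{(k)}(e^{-\eta hA}w)$, $g_\eta=g_\eta^{(0)}$. For $0\le\zeta\le1$, $$G_\zeta(\bullet)(w)=\int_0^\zeta e^{-(\zeta-\eta)hA}g_\eta(w)\,d\eta,\qquad G_\zeta([\tau_1,\dots,\tau_k])(w)=\int_0^\zeta e^{-(\zeta-\eta)hA}g_\eta^{(k)}(w)\bigl(G_\eta(\tau_1)(w),\dots,G_\eta(\tau_k)(w)\bigr)\,d\eta.$$ *)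

theory Defs
  imports "HOL-Analysis.Analysis" "HOL-Library.Multiset"
begin

subsection \<open>Strongly continuous semigroups and groups, and their generators\<close>

text \<open>An unbounded operator on \<open>'a\<close> is a partial map; its domain is \<open>dom A\<close>.  Linearity of the
  operators that occur below is not a separate condition: every generator is linear.\<close>

definition C0_semigroup :: "(real \<Rightarrow> 'a::banach \<Rightarrow>\<^sub>L 'a) \<Rightarrow> bool" where
  "C0_semigroup S \<longleftrightarrow> S 0 = id_blinfun
     \<and> (\<forall>s\<ge>0. \<forall>t\<ge>0. S (s + t) = S s o\<^sub>L S t)
     \<and> (\<forall>x. continuous_on {0..} (\<lambda>t. blinfun_apply (S t) x))"

definition C0_group :: "(real \<Rightarrow> 'a::banach \<Rightarrow>\<^sub>L 'a) \<Rightarrow> bool" where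
  "C0_group S \<longleftrightarrow> S 0 = id_blinfun
     \<and> (\<forall>s t. S (s + t) = S s o\<^sub>L S t)
     \<and> (\<forall>x. continuous_on UNIV (\<lambda>t. blinfun_apply (S t) x))"

definition semigroup_generated_by :: "('a::banach \<rightharpoonup> 'a) \<Rightarrow> (real \<Rightarrow> 'a \<Rightarrow>\<^sub>L 'a) \<Rightarrow> bool" where
  "semigroup_generated_by B S \<longleftrightarrow> C0_semigroup S
     \<and> (\<forall>x y. B x = Some y \<longleftrightarrow>
          ((\<lambda>t. (blinfun_apply (S t) x - x) /\<^sub>R t) \<longlongrightarrow> y) (at_right 0))"

definition group_generated_by :: "('a::banach \<rightharpoonup> 'a) \<Rightarrow> (real \<Rightarrow> 'a \<Rightarrow>\<^sub>L 'a) \<Rightarrow> bool" where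
  "group_generated_by B S \<longleftrightarrow> C0_group S
     \<and> (\<forall>x y. B x = Some y \<longleftrightarrow>
          ((\<lambda>t. (blinfun_apply (S t) x - x) /\<^sub>R t) \<longlongrightarrow> y) (at 0))"

definition neg_op :: "('a::banach \<rightharpoonup> 'a) \<Rightarrow> ('a \<rightharpoonup> 'a)" where
  "neg_op A = (\<lambda>x. map_option uminus (A x))"

text \<open>\<open>E A t\<close> stands for \<open>e\<^sup>-\<^sup>t\<^sup>A\<close>, which \<open>A\<close> determines for all \<open>t\<close> in the group case and for
  \<open>t \<ge> 0\<close> in the semigroup case; only \<open>t \<ge> 0\<close> is ever used in the latter.\<close>

definition exp_family ::
    "real \<Rightarrow> ('a::banach \<rightharpoonup> 'a) set \<Rightarrow> (('a \<rightharpoonup> 'a) \<Rightarrow> real \<Rightarrow> 'a \<Rightarrow>\<^sub>L 'a) \<Rightarrow> bool" where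
  "exp_family CF F E \<longleftrightarrow> (\<forall>A\<in>F.
       group_generated_by (neg_op A) (E A) \<and> (\<forall>t. norm (E A t) \<le> CF)
     \<or> semigroup_generated_by (neg_op A) (E A) \<and> (\<forall>t\<ge>0. norm (E A t) \<le> CF))"

subsection \<open>The solution and the neighbourhood of its trajectory\<close>

text \<open>The integral is the Henstock--Kurzweil integral of the library.\<close>

definition mild_solution ::
    "real \<Rightarrow> (real \<Rightarrow> 'a::banach \<Rightarrow>\<^sub>L 'a) \<Rightarrow> ('a \<Rightarrow> 'a) \<Rightarrow> 'a \<Rightarrow> (real \<Rightarrow> 'a) \<Rightarrow> bool" where
  "mild_solution T S g u0 u \<longleftrightarrow> (\<forall>t\<in>{0..T}.
       (\<lambda>s. blinfun_apply (S (t - s)) (g (u s))) integrable_on {0..t}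
     \<and> u t = blinfun_apply (S t) u0
             + integral {0..t} (\<lambda>s. blinfun_apply (S (t - s)) (g (u s))))"

definition tube :: "real \<Rightarrow> real \<Rightarrow> (real \<Rightarrow> 'a::banach) \<Rightarrow> 'a set" where
  "tube T r u = {v. \<exists>t\<in>{0..T}. norm (v - u t) < r}"

subsection \<open>Higher Frechet derivatives\<close>

text \<open>A \<open>k\<close>-linear map is represented by its action on lists of length \<open>k\<close>; its values on
  other lists are irrelevant.\<close>

definition bounded_multilinear :: "nat \<Rightarrow> ('a::real_normed_vector list \<Rightarrow> 'a) \<Rightarrow> bool" where
  "bounded_multilinear k L \<longleftrightarrow>
     (\<forall>vs i. length vs = k \<longrightarrow> i < k \<longrightarrow> linear (\<lambda>x. L (vs[i := x])))
   \<and> (\<exists>K. \<forall>vs. length vs = k \<longrightarrow> norm (L vs) \<le> K * prod_list (map norm vs))"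

text \<open>\<open>D k w [v\<^sub>1, \<dots>, v\<^sub>k]\<close> is the value at \<open>(v\<^sub>1, \<dots>, v\<^sub>k)\<close> of the \<open>k\<close>-th Frechet derivative of
  \<open>g\<close> at \<open>w\<close>, for all \<open>k \<le> p\<close> and all \<open>w\<close> in the open set \<open>U\<close>.  The last clause says that
  \<open>D (Suc k)\<close> is the Frechet derivative of \<open>D k\<close>, a map into the \<open>k\<close>-linear maps with the
  operator norm, under the identification of \<open>L(X, L\<^sup>k(X, X))\<close> with \<open>L\<^sup>k\<^sup>+\<^sup>1(X, X)\<close>.  The existence
  of such a \<open>D\<close> thus means that \<open>g\<close> is \<open>p\<close> times Frechet differentiable on \<open>U\<close>, and \<open>g\<close> determines
  \<open>D\<close> there.  Symmetry is a consequence, not part of the definition.\<close>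

definition frechet_derivs ::
    "nat \<Rightarrow> 'a::real_normed_vector set \<Rightarrow> ('a \<Rightarrow> 'a) \<Rightarrow> (nat \<Rightarrow> 'a \<Rightarrow> 'a list \<Rightarrow> 'a) \<Rightarrow> bool" where
  "frechet_derivs p U g D \<longleftrightarrow>
     (\<forall>w\<in>U. D 0 w [] = g w)
   \<and> (\<forall>k\<le>p. \<forall>w\<in>U. bounded_multilinear k (D k w))
   \<and> (\<forall>k<p. \<forall>w\<in>U. \<forall>e>0. \<exists>d>0. \<forall>v. norm v < d \<longrightarrow>
        (\<forall>vs. length vs = k \<longrightarrow>
           norm (D k (w + v) vs - D k w vs - D (Suc k) w (v # vs))
             \<le> e * norm v * prod_list (map norm vs)))"

definition derivs_bounded ::
    "nat \<Rightarrow> 'a::real_normed_vector set \<Rightarrow> (nat \<Rightarrow> real) \<Rightarrow> (nat \<Rightarrow> 'a \<Rightarrow> 'a list \<Rightarrow> 'a) \<Rightarrow> bool" where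
  "derivs_bounded p U M D \<longleftrightarrow>
     (\<forall>k\<le>p. \<forall>w\<in>U. \<forall>vs. length vs = k \<longrightarrow> norm (D k w vs) \<le> M k * prod_list (map norm vs))"

subsection \<open>Unlabeled rooted trees\<close>

text \<open>The single node is \<open>Node {#}\<close>; the general clauses below cover it, as empty sums are
  \<open>0\<close> and empty products are \<open>1\<close>.\<close>

datatype rtree = Node "rtree multiset"

primrec nodes :: "rtree \<Rightarrow> nat" where
  "nodes (Node ts) = Suc (sum_mset (image_mset nodes ts))"

primrec symcoef :: "rtree \<Rightarrow> nat" where
  "symcoef (Node ts) =
     prod_mset (image_mset symcoef ts) * (\<Prod>t\<in>set_mset ts. fact (count ts t))"

definition trees_upto :: "nat \<Rightarrow> rtree set" where
  "trees_upto p = {t. nodes t \<le> p}"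

lemma nodes_pos: "nodes t > 0"
  by (cases t) simp

lemma finite_trees_upto: "finite (trees_upto p)"
proof (induction p)
  case 0
  have "trees_upto 0 = {}" using nodes_pos by (auto simp: trees_upto_def)
  then show ?case by simp
next
  case (Suc p)
  let ?M = "\<Union>k\<le>p. multisets_of_size (trees_upto p) k"
  have "trees_upto (Suc p) \<subseteq> Node ` ?M"
  proof
    fix t assume t: "t \<in> trees_upto (Suc p)"
    obtain ts where ts: "t = Node ts" by (cases t)
    have sm: "sum_mset (image_mset nodes ts) \<le> p"
      using t by (simp add: ts trees_upto_def)
    have "size ts \<le> sum_mset (image_mset nodes ts)"
    proof (induction ts)
      case (add x ts)
      then show ?case using nodes_pos[of x] by simp
    qed simp
    moreover have "x \<in> trees_upto p" if x: "x \<in># ts" for x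
    proof -
      obtain us where "ts = add_mset x us" using mset_add[OF x] by blast
      then show ?thesis using sm by (simp add: trees_upto_def)
    qed
    ultimately have "ts \<in> ?M" using sm by (auto simp: multisets_of_size_def)
    then show "t \<in> Node ` ?M" unfolding ts by (rule imageI)
  qed
  moreover have "finite (Node ` ?M)"
    using finite_multisets_of_size[OF Suc] by (intro finite_imageI finite_UN_I) auto
  ultimately show ?case by (rule finite_subset)
qed

subsection \<open>Elementary integrals\<close>

text \<open>The arguments are listed in an arbitrary order, which does not matter because Frechet
  derivatives are symmetric.\<close>

definition apply_mset :: "('a list \<Rightarrow> 'a) \<Rightarrow> 'a multiset \<Rightarrow> 'a" where
  "apply_mset L V = L (SOME vs. mset vs = V)"

text \<open>\<open>elem_int S D h \<tau> \<zeta> w\<close> is \<open>G\<^sub>\<zeta>(\<tau>)(w)\<close>, where \<open>S t\<close> is \<open>e\<^sup>-\<^sup>t\<^sup>A\<close> and \<open>D k\<close> is the \<open>k\<close>-th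
  derivative of \<open>g\<close>.\<close>

primrec elem_int :: "(real \<Rightarrow> 'a::banach \<Rightarrow>\<^sub>L 'a) \<Rightarrow> (nat \<Rightarrow> 'a \<Rightarrow> 'a list \<Rightarrow> 'a) \<Rightarrow> real
    \<Rightarrow> rtree \<Rightarrow> real \<Rightarrow> 'a \<Rightarrow> 'a" where
  "elem_int S D h (Node ts) = (\<lambda>\<zeta> w. integral {0..\<zeta>} (\<lambda>\<eta>.
     blinfun_apply (S ((\<zeta> - \<eta>) * h))
       (apply_mset (D (size ts) (blinfun_apply (S (\<eta> * h)) w))
         (image_mset (\<lambda>G. G \<eta> w) (image_mset (elem_int S D h) ts)))))"

definition B_sum :: "nat \<Rightarrow> (real \<Rightarrow> 'a::banach \<Rightarrow>\<^sub>L 'a) \<Rightarrow> (nat \<Rightarrow> 'a \<Rightarrow> 'a list \<Rightarrow> 'a) \<Rightarrow> real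
    \<Rightarrow> 'a \<Rightarrow> real \<Rightarrow> 'a" where
  "B_sum p S D h w \<zeta> =
     (\<Sum>\<tau>\<in>trees_upto p. (h ^ nodes \<tau> / real (symcoef \<tau>)) *\<^sub>R elem_int S D h \<tau> \<zeta> w)"

end

theory Submission
  imports Defs "HOL-Combinatorics.Multiset_Permutations"
begin

text \<open>
The proof is by induction on \<open>p\<close>; each step passes once through the variation of constants formula.
Write \<open>S t\<close> for the semigroup and suppose that \<open>u (\<eta> h) = S (\<eta> h) u0 + B (\<eta>) + O(h\<^bsup>q+1\<^esup>)\<close> uniformly
for \<open>\<eta>\<close> in \<open>[0, 1]\<close>, where \<open>B\<close> is the sum over the trees with at most \<open>q\<close> nodes.  In the rescaled
equation
\<open>u (\<zeta> h) = S (\<zeta> h) u0 + h \<integral>\<^sub>0\<^sup>\<zeta> S ((\<zeta> - \<eta>) h) (g (u (\<eta> h))) d\<eta>\<close>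
the nonlinearity is expanded at the point \<open>S (\<eta> h) u0\<close> of the linear flow, up to the derivative of
order \<open>q\<close>.  The increment is \<open>O(h)\<close>, so the Taylor remainder is \<open>O(h\<^bsup>q+1\<^esup>)\<close>; replacing the increment
by \<open>B (\<eta>)\<close> in the Taylor polynomial costs another \<open>O(h\<^bsup>q+1\<^esup>)\<close>.  What remains is a sum of symmetric
multilinear maps applied to powers of a sum over trees.  Grouping the words of trees by their
multisets turns the multinomial numbers and the Taylor factors into symmetry coefficients
(\<open>multilinear_tree_sum\<close>), and the multisets with at most \<open>q\<close> nodes give exactly the integrands of the
trees with at most \<open>q + 1\<close> nodes; the other multisets are \<open>O(h\<^bsup>q+1\<^esup>)\<close>.  Integration multiplies the
total error by \<open>h\<close> (\<open>next_approx\<close>).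

Three points need care.  The derivatives are symmetric (\<open>frechet_derivs_perm\<close>), which is derived from
mere existence, without continuity of the highest one, by means of
\<open>second_derivative_symmetric\<close>; symmetry also allows the arguments in an elementary integral to be
put into an order that is the same for all times.  Integrals may be
subtracted: the integrand of the mild solution is integrable by the definition of a mild solution,
and the tree integrands are continuous (\<open>elem_int_regularity\<close>), so the error has an integral that is
bounded by its pointwise bound.  Finally the bounds are uniform: every constant is an explicit
function of the bounds on the semigroup and on the derivatives, and the step size is at most \<open>T\<close>, at
most \<open>1\<close>, and so small that the segment from the linear flow to the solution stays in the tube.
\<close>

section \<open>Calculus\<close>

text \<open>The derivative is only assumed to be differentiable at the single point \<open>w\<close>, so \<open>f''\<close> is read off
from the second difference \<open>f (w + t x + t y) - f (w + t x) - f (w + t y) + f w\<close>.  The mean value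
inequality, applied to \<open>f (w + t x + s t y) - f (w + s t y)\<close> as a function of \<open>s\<close>, shows that
this second difference is \<open>t\<^sup>2 f'' x y + o(t\<^sup>2)\<close>; its symmetry in \<open>x\<close> and \<open>y\<close> passes to \<open>f''\<close>.\<close>

lemma second_derivative_symmetric:
  fixes f :: "'a::real_normed_vector \<Rightarrow> 'b::real_normed_vector"
  assumes U: "open U" "w \<in> U"
    and f: "\<And>z. z \<in> U \<Longrightarrow> (f has_derivative f' z) (at z)"
    and f': "\<And>y. ((\<lambda>z. f' z y) has_derivative (\<lambda>v. f'' v y)) (at w)"
  shows "f'' x y = f'' y x"
proof -
  define \<Delta> where "\<Delta> a b t = f (w + t *\<^sub>R a + t *\<^sub>R b) - f (w + t *\<^sub>R a) - f (w + t *\<^sub>R b) + f w"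
    for a b and t :: real
  obtain d0 where d0: "d0 > 0" "ball w d0 \<subseteq> U"
    using U by (auto simp: open_contains_ball)
  have quotient: "\<exists>\<delta>>0. \<forall>t. 0 < t \<and> t < \<delta> \<longrightarrow> norm (\<Delta> a b t - t^2 *\<^sub>R f'' a b) \<le> e * t^2"
    if e: "e > 0" for a b e
  proof -
    \<comment> \<open>The displacements below have norm at most \<open>t * N\<close>; the added \<open>1\<close> makes \<open>N\<close> positive.\<close>
    define N where "N = norm a + norm b + 1"
    have N: "N > 0" unfolding N_def by (smt (verit) norm_ge_zero)
    obtain d where d: "d > 0"
      "\<And>v. norm v < d \<Longrightarrow> norm (f' (w + v) b - f' w b - f'' v b) \<le> e / (2 * N) * norm v"
    proof -
      have "e / (2 * N) > 0" using e N by simp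
      then obtain d where "d > 0"
        "\<forall>z. norm (z - w) < d \<longrightarrow> norm (f' z b - f' w b - f'' (z - w) b) \<le> e / (2 * N) * norm (z - w)"
        using f'[of b] unfolding has_derivative_at_alt by blast
      then show ?thesis by (intro that[of d]) (auto dest: spec[of _ "w + _"])
    qed
    have lin: "linear (\<lambda>v. f'' v b)"
      using f'[of b] has_derivative_linear by blast
    define \<delta> where "\<delta> = min d d0 / N"
    have "norm (\<Delta> a b t - t^2 *\<^sub>R f'' a b) \<le> e * t^2" if t: "0 < t" "t < \<delta>" for t
    proof -
      have tN: "t * N < min d d0" using t N by (simp add: \<delta>_def field_simps)
      have small: "norm (c *\<^sub>R a + (s * t) *\<^sub>R b) \<le> t * N"
        if "s \<in> {0..1}" "0 \<le> c" "c \<le> t" for s c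
      proof -
        have "norm (c *\<^sub>R a + (s * t) *\<^sub>R b) \<le> c * norm a + (s * t) * norm b"
          using norm_triangle_ineq[of "c *\<^sub>R a" "(s * t) *\<^sub>R b"] that t by simp
        also have "\<dots> \<le> t * norm a + t * norm b"
          using that t by (intro add_mono mult_right_mono) (auto simp: mult_left_le_one_le)
        also have "\<dots> \<le> t * N" using t by (simp add: N_def algebra_simps)
        finally show ?thesis .
      qed
      let ?z = "\<lambda>c s. w + (c *\<^sub>R a + (s * t) *\<^sub>R b)"
      have zU: "?z c s \<in> U" if "s \<in> {0..1}" "0 \<le> c" "c \<le> t" for s c
      proof (rule subsetD[OF d0(2)])
        have "dist (?z c s) w < d0"
          unfolding dist_norm add_diff_cancel_left' using small[OF that] tN by simp
        then show "?z c s \<in> ball w d0" by (simp only: mem_ball dist_commute)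
      qed
      \<comment> \<open>The increment of \<open>\<psi>\<close> over \<open>[0, 1]\<close> is the error of the second difference.\<close>
      define \<psi> where "\<psi> s = f (?z t s) - f (?z 0 s) - s *\<^sub>R (t^2 *\<^sub>R f'' a b)" for s
      define \<psi>' where "\<psi>' s = t *\<^sub>R f' (?z t s) b - t *\<^sub>R f' (?z 0 s) b - t^2 *\<^sub>R f'' a b" for s
      have df: "((\<lambda>s. f (?z c s)) has_derivative (\<lambda>\<sigma>. \<sigma> *\<^sub>R (t *\<^sub>R f' (?z c s) b))) (at s within {0..1})"
        if "s \<in> {0..1}" "0 \<le> c" "c \<le> t" for s c
      proof -
        have "((\<lambda>s. ?z c s) has_derivative (\<lambda>\<sigma>. (\<sigma> * t) *\<^sub>R b)) (at s within {0..1})"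
          by (auto intro!: derivative_eq_intros)
        from has_derivative_compose[OF this f[OF zU[OF that]]]
        moreover have "f' (?z c s) ((\<sigma> * t) *\<^sub>R b) = \<sigma> *\<^sub>R (t *\<^sub>R f' (?z c s) b)" for \<sigma>
          using linear_scale[OF has_derivative_linear[OF f[OF zU[OF that]]]] by simp
        ultimately show ?thesis by simp
      qed
      have "(\<psi> has_derivative (\<lambda>\<sigma>. \<sigma> *\<^sub>R \<psi>' s)) (at s within {0..1})" if s: "s \<in> {0..1}" for s
        unfolding \<psi>_def \<psi>'_def scaleR_diff_right
        by (intro has_derivative_diff df has_derivative_scaleR_left has_derivative_ident)
          (use s t in auto)
      moreover have "onorm (\<lambda>\<sigma>. \<sigma> *\<^sub>R \<psi>' s) \<le> e * t^2" if s: "s \<in> {0..1}" for s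
      proof (rule onorm_le)
        fix \<sigma> :: real
        let ?r = "\<lambda>v. f' (w + v) b - f' w b - f'' v b"
        let ?v1 = "t *\<^sub>R a + (s * t) *\<^sub>R b" and ?v0 = "0 *\<^sub>R a + (s * t) *\<^sub>R b"
        have r: "norm (?r v) \<le> e / (2 * N) * (t * N)" if "norm v \<le> t * N" for v
          using d(2)[of v] that tN e N by (smt (verit) divide_nonneg_nonneg mult_left_mono)
        have "\<psi>' s = t *\<^sub>R (?r ?v1 - ?r ?v0)"
          by (simp add: \<psi>'_def linear_add[OF lin] linear_scale[OF lin] algebra_simps power2_eq_square)
        then have "norm (\<psi>' s) = t * norm (?r ?v1 - ?r ?v0)"
          using t by (simp only: norm_scaleR abs_of_pos)
        also have "\<dots> \<le> t * (norm (?r ?v1) + norm (?r ?v0))"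
          using t by (intro mult_left_mono norm_triangle_ineq4) auto
        also have "\<dots> \<le> t * (e / (2 * N) * (t * N) + e / (2 * N) * (t * N))"
          using t s by (intro mult_left_mono add_mono r small) auto
        also have "\<dots> = e * t^2" using N by (simp add: field_simps power2_eq_square)
        finally show "norm (\<sigma> *\<^sub>R \<psi>' s) \<le> e * t^2 * norm \<sigma>"
          by (simp add: mult_left_mono mult.commute)
      qed
      ultimately have "norm (\<psi> 1 - \<psi> 0) \<le> e * t^2 * norm (1 - 0 :: real)"
        by (intro differentiable_bound[where S = "{0..1}" and f' = "\<lambda>s \<sigma>. \<sigma> *\<^sub>R \<psi>' s"]) auto
      moreover have "\<psi> 1 - \<psi> 0 = \<Delta> a b t - t^2 *\<^sub>R f'' a b"
        by (simp add: \<psi>_def \<Delta>_def algebra_simps)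
      ultimately show ?thesis by simp
    qed
    moreover have "\<delta> > 0" using d(1) d0(1) N by (simp add: \<delta>_def)
    ultimately show ?thesis by blast
  qed
  have "norm (f'' x y - f'' y x) \<le> e" if e: "e > 0" for e
  proof -
    have e2: "e / 2 > 0" using e by simp
    obtain \<delta>1 where \<delta>1: "\<delta>1 > 0"
      "\<And>t. 0 < t \<Longrightarrow> t < \<delta>1 \<Longrightarrow> norm (\<Delta> x y t - t^2 *\<^sub>R f'' x y) \<le> e / 2 * t^2"
      using quotient[OF e2, of x y] by blast
    obtain \<delta>2 where \<delta>2: "\<delta>2 > 0"
      "\<And>t. 0 < t \<Longrightarrow> t < \<delta>2 \<Longrightarrow> norm (\<Delta> y x t - t^2 *\<^sub>R f'' y x) \<le> e / 2 * t^2"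
      using quotient[OF e2, of y x] by blast
    define t where "t = min \<delta>1 \<delta>2 / 2"
    have t: "0 < t" "t < \<delta>1" "t < \<delta>2" using \<delta>1 \<delta>2 by (auto simp: t_def)
    have "\<Delta> x y t = \<Delta> y x t" by (simp add: \<Delta>_def algebra_simps)
    then have "t^2 *\<^sub>R (f'' x y - f'' y x)
        = (\<Delta> y x t - t^2 *\<^sub>R f'' y x) - (\<Delta> x y t - t^2 *\<^sub>R f'' x y)"
      by (simp add: algebra_simps)
    then have "norm (t^2 *\<^sub>R (f'' x y - f'' y x)) \<le> e / 2 * t^2 + e / 2 * t^2"
      using \<delta>1(2)[OF t(1,2)] \<delta>2(2)[OF t(1,3)] norm_triangle_ineq4 by (smt (verit))
    then have "t^2 * norm (f'' x y - f'' y x) \<le> t^2 * e" by (simp add: mult.commute)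
    then show ?thesis using t(1) by simp
  qed
  then have "norm (f'' x y - f'' y x) \<le> 0" by (metis dense_ge)
  then show ?thesis by simp
qed

text \<open>The derivative of the Taylor remainder of \<open>\<phi> 0\<close> is the remainder, of one order less, of \<open>\<phi> 1\<close>, and the
remainder vanishes at \<open>0\<close>; so the mean value inequality transports the bound from \<open>\<phi> p\<close> down to
\<open>\<phi> 0\<close>.  The factor \<open>1 / fact p\<close> is lost on the way.  The last
derivative enters through its bound, which is all that mere differentiability provides.\<close>

lemma taylor_remainder_bound:
  fixes \<phi> :: "nat \<Rightarrow> real \<Rightarrow> 'a::real_normed_vector"
  assumes "\<And>k t. k < p \<Longrightarrow> t \<in> {0..1} \<Longrightarrow>
      (\<phi> k has_vector_derivative \<phi> (Suc k) t) (at t within {0..1})"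
    and "\<And>t. t \<in> {0..1} \<Longrightarrow> norm (\<phi> p t) \<le> B"
    and "t \<in> {0..1}"
  shows "norm (\<phi> 0 t - (\<Sum>k<p. (t ^ k / fact k) *\<^sub>R \<phi> k 0)) \<le> B"
  using assms
proof (induction p arbitrary: \<phi> t)
  case 0
  then show ?case by simp
next
  case (Suc p)
  define \<psi> where "\<psi> s = \<phi> 0 s - (\<Sum>k<Suc p. (s ^ k / fact k) *\<^sub>R \<phi> k 0)" for s
  define \<psi>' where "\<psi>' s = \<phi> 1 s - (\<Sum>k<p. (s ^ k / fact k) *\<^sub>R \<phi> (Suc k) 0)" for s
  have IH: "norm (\<psi>' s) \<le> B" if "s \<in> {0..1}" for s
    using Suc.IH[of "\<lambda>k. \<phi> (Suc k)" s] Suc.prems that by (simp add: \<psi>'_def)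
  have B: "B \<ge> 0" using order_trans[OF norm_ge_zero IH[of 0]] by simp
  have \<psi>_alt: "\<psi> = (\<lambda>s. \<phi> 0 s - (\<phi> 0 0 + (\<Sum>k<p. (s ^ Suc k / fact (Suc k)) *\<^sub>R \<phi> (Suc k) 0)))"
    by (simp add: fun_eq_iff \<psi>_def sum.lessThan_Suc_shift del: sum.lessThan_Suc fact_Suc power_Suc)
  have der: "(\<psi> has_vector_derivative \<psi>' s) (at s within {0..1})" if s: "s \<in> {0..1}" for s
  proof -
    have pow: "((\<lambda>s. (s ^ Suc k / fact (Suc k)) *\<^sub>R v) has_vector_derivative (s ^ k / fact k) *\<^sub>R v)
        (at s within {0..1})" for k and v :: 'a
    proof -
      have der: "((\<lambda>s::real. s ^ Suc k / fact (Suc k)) has_real_derivative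
          (of_nat (Suc k) * s ^ k / fact (Suc k))) (at s within {0..1})"
        using DERIV_pow[of "Suc k" s "{0..1}"] by (intro DERIV_cdivide) simp
      moreover have "of_nat (Suc k) * s ^ k / fact (Suc k) = s ^ k / fact k"
        by (simp add: divide_simps del: of_nat_Suc)
      ultimately show ?thesis
        using has_vector_derivative_scaleR[OF der has_vector_derivative_const[of v]]
        by (simp del: fact_Suc of_nat_Suc power_Suc)
    qed
    have "(\<psi> has_vector_derivative (\<phi> (Suc 0) s - (0 + (\<Sum>k<p. (s ^ k / fact k) *\<^sub>R \<phi> (Suc k) 0))))
        (at s within {0..1})"
      unfolding \<psi>_alt
      by (intro has_vector_derivative_diff has_vector_derivative_add has_vector_derivative_const
          has_vector_derivative_sum pow Suc.prems s) auto
    then show ?thesis by (simp add: \<psi>'_def)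
  qed
  have "norm (\<psi> t - \<psi> 0) \<le> B * norm (t - 0)"
  proof (rule differentiable_bound[where S = "{0..1}" and f' = "\<lambda>s \<sigma>. \<sigma> *\<^sub>R \<psi>' s"])
    show "onorm (\<lambda>\<sigma>. \<sigma> *\<^sub>R \<psi>' s) \<le> B" if "s \<in> {0..1}" for s
      using IH[OF that] by (intro onorm_le) (simp add: mult.commute[of B] mult_left_mono)
  qed (use der Suc.prems(3) in \<open>auto simp: has_vector_derivative_def\<close>)
  also have "\<dots> \<le> B" using Suc.prems(3) B by (simp add: mult_left_le)
  also have "\<psi> 0 = 0" by (simp add: \<psi>_alt)
  finally have "norm (\<psi> t) \<le> B" by simp
  then show ?case unfolding \<psi>_def .
qed

text \<open>The substitution \<open>\<eta> = \<zeta> s\<close> makes the interval of integration independent of \<open>\<zeta>\<close>.\<close>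

lemma continuous_on_subinterval_integral:
  fixes f :: "real \<Rightarrow> real \<Rightarrow> 'a::banach"
  assumes f: "continuous_on {(\<zeta>, \<eta>). 0 \<le> \<eta> \<and> \<eta> \<le> \<zeta> \<and> \<zeta> \<le> c} (\<lambda>(\<zeta>, \<eta>). f \<zeta> \<eta>)"
  shows "continuous_on {0..c} (\<lambda>\<zeta>. integral {0..\<zeta>} (f \<zeta>))"
proof -
  have "continuous_on ({0..c} \<times> cbox 0 1) (\<lambda>(\<zeta>, s). f \<zeta> (\<zeta> * s))"
  proof -
    have "continuous_on ({0..c} \<times> cbox 0 1) ((\<lambda>(\<zeta>, \<eta>). f \<zeta> \<eta>) \<circ> (\<lambda>(\<zeta>, s). (\<zeta>, \<zeta> * s)))"
    proof (rule continuous_on_compose)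
      show "continuous_on ({0..c} \<times> cbox 0 1) (\<lambda>(\<zeta>::real, s). (\<zeta>, \<zeta> * s))"
        unfolding case_prod_unfold by (intro continuous_intros)
      show "continuous_on ((\<lambda>(\<zeta>, s). (\<zeta>, \<zeta> * s)) ` ({0..c} \<times> cbox 0 1)) (\<lambda>(\<zeta>, \<eta>). f \<zeta> \<eta>)"
        by (rule continuous_on_subset[OF f]) (auto simp: mult_left_le)
    qed
    then show ?thesis by (simp add: o_def case_prod_unfold)
  qed
  then have "continuous_on {0..c} (\<lambda>\<zeta>. \<zeta> *\<^sub>R integral (cbox 0 1) (\<lambda>s. f \<zeta> (\<zeta> * s)))"
    by (intro continuous_intros integral_continuous_on_param)
  moreover have "\<zeta> *\<^sub>R integral (cbox 0 1) (\<lambda>s. f \<zeta> (\<zeta> * s)) = integral {0..\<zeta>} (f \<zeta>)"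
    if \<zeta>: "\<zeta> \<in> {0..c}" for \<zeta>
  proof (cases "\<zeta> = 0")
    case False
    have "continuous_on {0..\<zeta>} ((\<lambda>(\<zeta>, \<eta>). f \<zeta> \<eta>) \<circ> (\<lambda>\<eta>. (\<zeta>, \<eta>)))"
      by (intro continuous_on_compose continuous_intros continuous_on_subset[OF f]) (use \<zeta> in auto)
    then have "(f \<zeta> has_integral integral {0..\<zeta>} (f \<zeta>)) {0..\<zeta>}"
      by (intro integrable_integral integrable_continuous_real) (simp add: o_def)
    from has_integral_stretch_real[OF this False] False \<zeta>
    have "((\<lambda>s. f \<zeta> (\<zeta> * s)) has_integral (1 / \<zeta>) *\<^sub>R integral {0..\<zeta>} (f \<zeta>)) {0..1}"
      by (simp add: image_divide_atLeastAtMost)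
    then show ?thesis using False by (simp add: integral_unique)
  qed simp
  ultimately show ?thesis by (rule continuous_on_eq)
qed

lemma norm_integral_le:
  fixes f :: "real \<Rightarrow> 'a::banach"
  assumes "f integrable_on {0..c}" "0 \<le> c" "\<And>x. x \<in> {0..c} \<Longrightarrow> norm (f x) \<le> B"
  shows "norm (integral {0..c} f) \<le> B * c"
proof -
  have "B \<ge> 0" using order_trans[OF norm_ge_zero assms(3)[of 0]] assms(2) by simp
  from has_integral_bound[OF this, of f "integral {0..c} f" 0 c] show ?thesis
    using assms by (simp add: has_integral_integral)
qed

section \<open>Bounded multilinear maps\<close>

text \<open>Splitting a list at a slot, instead of updating it at an index, lets the lemmas below recurse along
the list of arguments.\<close>

lemma bounded_multilinear_slot:
  assumes "bounded_multilinear k L" "length xs + Suc (length ys) = k"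
  shows "linear (\<lambda>x. L (xs @ x # ys))"
proof -
  have "length (xs @ 0 # ys) = k" "length xs < k" using assms(2) by auto
  then have "linear (\<lambda>x. L ((xs @ 0 # ys)[length xs := x]))"
    using assms(1) unfolding bounded_multilinear_def by blast
  then show ?thesis by simp
qed

lemma prod_list_norm_nonneg: "prod_list (map norm (vs :: 'a::real_normed_vector list)) \<ge> 0"
  by (induction vs) auto

lemma prod_list_norm_le_power:
  fixes vs :: "'a::real_normed_vector list"
  assumes "\<And>v. v \<in> set vs \<Longrightarrow> norm v \<le> R" "R \<ge> 0"
  shows "prod_list (map norm vs) \<le> R ^ length vs"
  using assms by (induction vs) (auto intro!: mult_mono prod_list_norm_nonneg)

text \<open>The arguments are exchanged one after the other; \<open>ps\<close> holds those already exchanged.\<close>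

lemma multilinear_difference_bound:
  assumes L: "bounded_multilinear k L"
    and K: "\<And>vs. length vs = k \<Longrightarrow> norm (L vs) \<le> K * prod_list (map norm vs)" "K \<ge> 0"
    and len: "length ps + length vs = k"
    and R: "\<And>v. v \<in> set ps \<union> set vs \<union> set vs' \<Longrightarrow> norm v \<le> R" "R \<ge> 0"
    and d: "list_all2 (\<lambda>v v'. norm (v - v') \<le> d) vs vs'" "d \<ge> 0"
  shows "norm (L (ps @ vs) - L (ps @ vs')) \<le> K * length vs * R ^ (k - 1) * d"
  using d(1) len R(1)
proof (induction arbitrary: ps rule: list_all2_induct)
  case Nil
  then show ?case by simp
next
  case (Cons v vs v' vs')
  note lin = bounded_multilinear_slot[OF L, of ps vs]
  have "length vs' = length vs" using Cons.hyps by (simp add: list_all2_lengthD)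
  have "norm (L (ps @ (v - v') # vs)) \<le> K * R ^ (k - 1) * d"
  proof -
    have "norm (L (ps @ (v - v') # vs)) \<le> K * prod_list (map norm (ps @ (v - v') # vs))"
      using Cons.prems by (intro K) auto
    also have "\<dots> = K * prod_list (map norm (ps @ vs)) * norm (v - v')"
      by simp
    also have "\<dots> \<le> K * R ^ length (ps @ vs) * d"
    proof (intro mult_mono prod_list_norm_le_power)
      show "norm x \<le> R" if "x \<in> set (ps @ vs)" for x using Cons.prems that by auto
      show "norm (v - v') \<le> d" by fact
    qed (use K R(2) prod_list_norm_nonneg[of "ps @ vs"] in auto)
    also have "length (ps @ vs) = k - 1" using Cons.prems by auto
    finally show ?thesis .
  qed
  moreover have "norm (L ((ps @ [v']) @ vs) - L ((ps @ [v']) @ vs')) \<le> K * length vs * R ^ (k - 1) * d"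
    using Cons.prems by (intro Cons.IH) auto
  moreover have "L (ps @ v # vs) - L (ps @ v' # vs')
      = L (ps @ (v - v') # vs) + (L ((ps @ [v']) @ vs) - L ((ps @ [v']) @ vs'))"
    using linear_diff[OF lin, of v v'] Cons.prems by simp
  ultimately have "norm (L (ps @ v # vs) - L (ps @ v' # vs'))
      \<le> K * R ^ (k - 1) * d + K * length vs * R ^ (k - 1) * d"
    by (metis (no_types, lifting) norm_triangle_mono)
  then show ?case by (simp add: algebra_simps)
qed

text \<open>A power of a sum is the sum over all words of the corresponding length.\<close>

lemma multilinear_sum_expansion:
  assumes L: "bounded_multilinear n L" and fin: "finite A" and "length ps + k = n"
  shows "L (ps @ replicate k (\<Sum>a\<in>A. c a *\<^sub>R G a))
       = (\<Sum>as | set as \<subseteq> A \<and> length as = k. prod_list (map c as) *\<^sub>R L (ps @ map G as))"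
  using assms(3)
proof (induction k arbitrary: ps)
  case 0
  have "{as. set as \<subseteq> A \<and> length as = 0} = {[]}" by auto
  then show ?case by simp
next
  case (Suc k)
  let ?s = "\<Sum>a\<in>A. c a *\<^sub>R G a" and ?A = "\<lambda>k. {as. set as \<subseteq> A \<and> length as = k}"
  have lin: "linear (\<lambda>x. L (ps @ x # replicate k ?s))"
    using Suc.prems by (intro bounded_multilinear_slot[OF L]) auto
  have "L (ps @ replicate (Suc k) ?s) = (\<Sum>a\<in>A. c a *\<^sub>R L (ps @ G a # replicate k ?s))"
    using linear_sum[OF lin, of "\<lambda>a. c a *\<^sub>R G a" A] by (simp add: linear_scale[OF lin])
  also have "\<dots> = (\<Sum>a\<in>A. c a *\<^sub>R (\<Sum>as\<in>?A k. prod_list (map c as) *\<^sub>R L ((ps @ [G a]) @ map G as)))"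
    using Suc.prems by (subst Suc.IH[symmetric]) auto
  also have "\<dots> = (\<Sum>(a, as)\<in>A \<times> ?A k. prod_list (map c (a # as)) *\<^sub>R L (ps @ map G (a # as)))"
    by (simp add: scaleR_sum_right sum.cartesian_product)
  also have "\<dots> = (\<Sum>as\<in>?A (Suc k). prod_list (map c as) *\<^sub>R L (ps @ map G as))"
    by (rule sum.reindex_bij_witness[of _ "\<lambda>as. (hd as, tl as)" "\<lambda>(a, as). a # as"])
      (auto simp: length_Suc_conv)
  finally show ?case .
qed

section \<open>Powers of a tree sum under a symmetric multilinear map\<close>

text \<open>A multiset \<open>m\<close> of size \<open>k\<close> has \<open>k! / \<Prod>\<^sub>a (count m a)!\<close> arrangements.\<close>

lemma sum_lists_by_mset:
  fixes F :: "'b multiset \<Rightarrow> 'a::real_vector"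
  assumes "finite A"
  shows "(\<Sum>as | set as \<subseteq> A \<and> length as = k. F (mset as))
       = (\<Sum>m\<in>multisets_of_size A k. (fact k / (\<Prod>a\<in>set_mset m. fact (count m a))) *\<^sub>R F m)"
proof -
  let ?L = "{as. set as \<subseteq> A \<and> length as = k}"
  have "(\<Sum>as\<in>?L. F (mset as)) = (\<Sum>m\<in>multisets_of_size A k. \<Sum>as | as \<in> ?L \<and> mset as = m. F (mset as))"
    by (rule sum.group[symmetric])
      (use assms in \<open>auto simp: finite_lists_length_eq multisets_of_size_def intro!: finite_multisets_of_size[unfolded multisets_of_size_def]\<close>)
  also have "\<dots> = (\<Sum>m\<in>multisets_of_size A k. (fact k / (\<Prod>a\<in>set_mset m. fact (count m a))) *\<^sub>R F m)"
  proof (rule sum.cong[OF refl])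
    fix m assume "m \<in> multisets_of_size A k"
    then have m: "set_mset m \<subseteq> A" "size m = k" by (auto simp: multisets_of_size_def)
    have "{as. as \<in> ?L \<and> mset as = m} = permutations_of_multiset m"
      using m by (auto simp: permutations_of_multiset_def)
    moreover have "real (card (permutations_of_multiset m)) = fact k / (\<Prod>a\<in>set_mset m. fact (count m a))"
      using card_permutations_of_multiset[of m] m(2)
      by (simp add: real_of_nat_div)
    ultimately show "(\<Sum>as | as \<in> ?L \<and> mset as = m. F (mset as))
        = (fact k / (\<Prod>a\<in>set_mset m. fact (count m a))) *\<^sub>R F m"
      by (simp add: permutations_of_multiset_def sum_constant_scaleR)
  qed
  finally show ?thesis .
qed

lemma nodes_le_sum_nodes: "t \<in># m \<Longrightarrow> nodes t \<le> sum_mset (image_mset nodes m)"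
proof -
  assume "t \<in># m"
  then obtain m' where "m = add_mset t m'" by (rule mset_add)
  then show ?thesis by simp
qed

lemma size_le_sum_nodes: "size m \<le> sum_mset (image_mset nodes m)"
proof (induction m)
  case (add t m)
  then show ?case using nodes_pos[of t] by simp
qed simp

lemma symcoef_pos: "symcoef t > 0"
proof (induction t)
  case (Node ts)
  then show ?case by (induction ts) (auto simp: prod_pos)
qed

text \<open>The reason for the symmetry coefficients.  Expanding \<open>L\<close> gives one term for each word of trees; by
symmetry, words with the same multiset \<open>m\<close> of letters give the same term.  Their number is
\<open>k! / \<Prod> (count m t)!\<close>, whose numerator cancels the Taylor factor, and whose denominator
joins the coefficients of the letters to form \<open>symcoef (Node m)\<close>.  The root of \<open>Node m\<close> carries no
power of \<open>h\<close> yet: that one comes from the integration over \<open>\<eta>\<close>.\<close>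

lemma multilinear_tree_sum:
  assumes L: "bounded_multilinear k L" and A: "finite A"
    and sym: "\<And>vs. length vs = k \<Longrightarrow> apply_mset L (mset vs) = L vs"
  shows "(1 / fact k) *\<^sub>R L (replicate k (\<Sum>\<tau>\<in>A. (h ^ nodes \<tau> / real (symcoef \<tau>)) *\<^sub>R G \<tau>))
       = (\<Sum>m\<in>multisets_of_size A k.
            (h ^ (nodes (Node m) - 1) / real (symcoef (Node m))) *\<^sub>R apply_mset L (image_mset G m))"
proof -
  define c where "c \<tau> = h ^ nodes \<tau> / real (symcoef \<tau>)" for \<tau>
  have "L (replicate k (\<Sum>\<tau>\<in>A. c \<tau> *\<^sub>R G \<tau>))
      = (\<Sum>as | set as \<subseteq> A \<and> length as = k. prod_list (map c as) *\<^sub>R L (map G as))"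
    using multilinear_sum_expansion[OF L A, of "[]" k c G] by simp
  also have "\<dots> = (\<Sum>as | set as \<subseteq> A \<and> length as = k.
      prod_mset (image_mset c (mset as)) *\<^sub>R apply_mset L (image_mset G (mset as)))"
    using sym by (intro sum.cong refl) (simp flip: mset_map prod_mset_prod_list)
  also have "\<dots> = (\<Sum>m\<in>multisets_of_size A k. (fact k / (\<Prod>a\<in>set_mset m. fact (count m a))) *\<^sub>R
      (prod_mset (image_mset c m) *\<^sub>R apply_mset L (image_mset G m)))"
    by (rule sum_lists_by_mset[OF A])
  finally have "(1 / fact k) *\<^sub>R L (replicate k (\<Sum>\<tau>\<in>A. c \<tau> *\<^sub>R G \<tau>))
      = (\<Sum>m\<in>multisets_of_size A k. (prod_mset (image_mset c m) / (\<Prod>a\<in>set_mset m. fact (count m a))) *\<^sub>R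
          apply_mset L (image_mset G m))"
    by (simp add: scaleR_sum_right)
  moreover have "prod_mset (image_mset c m)
      = h ^ sum_mset (image_mset nodes m) / real (prod_mset (image_mset symcoef m))" for m
    by (induction m) (auto simp: c_def power_add)
  ultimately show ?thesis
    by (simp add: c_def)
qed

definition forests_upto :: "nat \<Rightarrow> rtree multiset set" where
  "forests_upto q = {m. sum_mset (image_mset nodes m) \<le> q}"

text \<open>The forests that occur when powers up to \<open>q\<close> of a sum over \<open>trees_upto q\<close> are expanded.  Those
outside \<open>forests_upto q\<close> contribute to the error term.\<close>

definition product_forests :: "nat \<Rightarrow> rtree multiset set" where
  "product_forests q = (\<Union>k<Suc q. multisets_of_size (trees_upto q) k)"

lemma finite_product_forests: "finite (product_forests q)"
  unfolding product_forests_def by (intro finite_UN_I finite_multisets_of_size finite_trees_upto) auto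

lemma forests_upto_subset: "forests_upto q \<subseteq> product_forests q"
proof
  fix m assume "m \<in> forests_upto q"
  then have m: "sum_mset (image_mset nodes m) \<le> q" by (simp add: forests_upto_def)
  have "t \<in> trees_upto q" if t: "t \<in># m" for t
    using nodes_le_sum_nodes[OF t] m by (simp add: trees_upto_def)
  then show "m \<in> product_forests q"
    using m size_le_sum_nodes[of m] by (auto simp: product_forests_def multisets_of_size_def)
qed

lemma trees_upto_Suc: "trees_upto (Suc q) = Node ` forests_upto q"
proof (rule set_eqI)
  show "t \<in> trees_upto (Suc q) \<longleftrightarrow> t \<in> Node ` forests_upto q" for t
    by (cases t) (auto simp: trees_upto_def forests_upto_def)
qed

section \<open>Higher Frechet derivatives\<close>

lemma frechet_derivs_differentiability:
  assumes "frechet_derivs p U g D" "k < p" "w \<in> U" "e > 0"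
  obtains d where "d > 0" "\<And>v vs. norm v < d \<Longrightarrow> length vs = k \<Longrightarrow>
    norm (D k (w + v) vs - D k w vs - D (Suc k) w (v # vs)) \<le> e * norm v * prod_list (map norm vs)"
proof -
  have "\<exists>d>0. \<forall>v. norm v < d \<longrightarrow> (\<forall>vs. length vs = k \<longrightarrow>
    norm (D k (w + v) vs - D k w vs - D (Suc k) w (v # vs)) \<le> e * norm v * prod_list (map norm vs))"
    using assms(1)[unfolded frechet_derivs_def, THEN conjunct2, THEN conjunct2, rule_format, OF assms(2-4)] .
  then obtain d where d: "d > 0" "\<forall>v. norm v < d \<longrightarrow> (\<forall>vs. length vs = k \<longrightarrow>
    norm (D k (w + v) vs - D k w vs - D (Suc k) w (v # vs)) \<le> e * norm v * prod_list (map norm vs))"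
    by (elim exE conjE)
  show thesis using d(2) by (intro that[OF d(1)]) simp
qed

lemma frechet_derivs_has_derivative:
  assumes D: "frechet_derivs p U g D" and k: "k < p" and w: "w \<in> U" and len: "length vs = k"
  shows "((\<lambda>z. D k z vs) has_derivative (\<lambda>v. D (Suc k) w (v # vs))) (at w)"
  unfolding has_derivative_at_alt
proof (intro conjI allI impI)
  let ?P = "prod_list (map norm vs)"
  have P: "?P \<ge> 0" by (rule prod_list_norm_nonneg)
  have L: "bounded_multilinear (Suc k) (D (Suc k) w)"
    using D k w by (auto simp: frechet_derivs_def)
  have lin: "linear (\<lambda>v. D (Suc k) w (v # vs))"
    using bounded_multilinear_slot[OF L, of "[]" vs] len by simp
  obtain K where K: "\<And>vs. length vs = Suc k \<Longrightarrow> norm (D (Suc k) w vs) \<le> K * prod_list (map norm vs)"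
    using L by (auto simp: bounded_multilinear_def)
  show "bounded_linear (\<lambda>v. D (Suc k) w (v # vs))"
  proof (rule bounded_linear_intro)
    show "norm (D (Suc k) w (v # vs)) \<le> norm v * (K * ?P)" for v
      using K[of "v # vs"] len by (simp add: algebra_simps)
  qed (use linear_add[OF lin] linear_scale[OF lin] in auto)
  fix e :: real assume e: "e > 0"
  then have "e / (?P + 1) > 0" using P by simp
  then obtain d where d: "d > 0" "\<And>v. norm v < d \<Longrightarrow>
      norm (D k (w + v) vs - D k w vs - D (Suc k) w (v # vs)) \<le> e / (?P + 1) * norm v * ?P"
    using frechet_derivs_differentiability[OF D k w, of "e / (?P + 1)"] len by metis
  have "norm (D k z vs - D k w vs - D (Suc k) w ((z - w) # vs)) \<le> e * norm (z - w)"
    if z: "norm (z - w) < d" for z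
  proof -
    have "e / (?P + 1) * ?P \<le> e" using P e by (simp add: field_simps)
    from mult_right_mono[OF this, of "norm (z - w)"]
    have "e / (?P + 1) * norm (z - w) * ?P \<le> e * norm (z - w)"
      by (simp add: mult_ac)
    moreover have "norm (D k z vs - D k w vs - D (Suc k) w ((z - w) # vs)) \<le> e / (?P + 1) * norm (z - w) * ?P"
      using d(2)[OF z] by (simp only: add_diff_cancel_left' diff_add_cancel add.commute[of w])
    ultimately show ?thesis by (rule order_trans[rotated])
  qed
  then show "\<exists>d>0. \<forall>z. norm (z - w) < d \<longrightarrow>
      norm (D k z vs - D k w vs - D (Suc k) w ((z - w) # vs)) \<le> e * norm (z - w)"
    using d(1) by blast
qed

text \<open>By induction on the order.  Differentiating the symmetry of \<open>D k\<close>, which holds near \<open>w\<close>, gives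
symmetry of \<open>D (Suc k) w\<close> in all arguments but the first.  The first two may be exchanged by the
symmetry of second derivatives.  To bring \<open>a # as\<close> into the form \<open>b # bs\<close> with \<open>a \<noteq> b\<close>, move
\<open>b\<close> to the second place, exchange, and rearrange the rest.\<close>

lemma frechet_derivs_perm:
  assumes D: "frechet_derivs p U g D" and U: "open U"
    and "k \<le> p" "w \<in> U" "length vs = k" "mset vs = mset vs'"
  shows "D k w vs = D k w vs'"
  using assms(3-)
proof (induction k arbitrary: w vs vs')
  case 0
  then show ?case by simp
next
  case (Suc k)
  have k: "k < p" using Suc.prems by simp
  have tail: "D (Suc k) w (x # as) = D (Suc k) w (x # bs)"
    if as: "length as = k" "mset as = mset bs" for x as bs
  proof -
    have bs: "length bs = k" using as mset_eq_length by metis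
    have "((\<lambda>z. D k z as) has_derivative (\<lambda>v. D (Suc k) w (v # bs))) (at w)"
      using frechet_derivs_has_derivative[OF D k Suc.prems(2) bs]
      by (rule has_derivative_transform_within_open[OF _ U Suc.prems(2)])
        (use Suc.IH as k in \<open>auto simp: less_imp_le\<close>)
    then have "(\<lambda>v. D (Suc k) w (v # as)) = (\<lambda>v. D (Suc k) w (v # bs))"
      using frechet_derivs_has_derivative[OF D k Suc.prems(2) as(1)] has_derivative_unique by blast
    then show ?thesis by metis
  qed
  obtain a as where vs: "vs = a # as" using Suc.prems by (cases vs) auto
  obtain b bs where vs': "vs' = b # bs" using Suc.prems mset_eq_length[of vs vs'] by (cases vs') auto
  have as: "length as = k" using Suc.prems vs by simp
  show ?case
  proof (cases "a = b")
    case True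
    then show ?thesis using tail[of as bs a] as Suc.prems vs vs' by simp
  next
    case False
    have "add_mset a (mset as) = add_mset b (mset bs)" using Suc.prems vs vs' by simp
    then obtain C where C: "mset as = add_mset b C" "mset bs = add_mset a C"
      using False by (auto simp: add_eq_conv_ex)
    obtain cs where cs: "mset cs = C" using ex_mset by blast
    obtain j where j: "k = Suc j" "length cs = j"
    proof -
      have "k = Suc (length cs)" using as C(1) cs by (metis size_add_mset size_mset)
      then show ?thesis using that by blast
    qed
    have "D (Suc k) w (a # as) = D (Suc k) w (a # b # cs)"
      using tail[of as "b # cs"] as C cs by simp
    also have "\<dots> = D (Suc k) w (b # a # cs)"
      unfolding j(1)
    proof (rule second_derivative_symmetric[OF U Suc.prems(2),
          where f = "\<lambda>z. D j z cs" and f' = "\<lambda>z v. D (Suc j) z (v # cs)"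
            and f'' = "\<lambda>v v'. D (Suc (Suc j)) w (v # v' # cs)"])
      show "((\<lambda>z. D j z cs) has_derivative (\<lambda>v. D (Suc j) z (v # cs))) (at z)" if "z \<in> U" for z
        by (rule frechet_derivs_has_derivative[OF D _ that j(2)]) (use j k in simp)
      show "((\<lambda>z. D (Suc j) z (y # cs)) has_derivative (\<lambda>v. D (Suc (Suc j)) w (v # y # cs))) (at w)" for y
        by (rule frechet_derivs_has_derivative[OF D _ Suc.prems(2)]) (use j k in simp_all)
    qed
    also have "\<dots> = D (Suc k) w (b # bs)"
      using tail[of "a # cs" bs] j C cs by simp
    finally show ?thesis using vs vs' by simp
  qed
qed

lemma frechet_derivs_apply_mset:
  assumes "frechet_derivs p U g D" "open U" "length vs \<le> p" "w \<in> U"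
  shows "apply_mset (D (length vs) w) (mset vs) = D (length vs) w vs"
proof -
  have "mset (SOME us. mset us = mset vs) = mset vs"
    by (rule someI[of _ vs]) simp
  then show ?thesis
    unfolding apply_mset_def using frechet_derivs_perm[OF assms(1,2,3,4)] by metis
qed

text \<open>Differentiability of \<open>D k\<close> controls the change of the base point, multilinearity the change of the
arguments.  Continuity holds for orders below \<open>p\<close>, which is what the integrands of trees with at
most \<open>p\<close> nodes use.\<close>

lemma frechet_derivs_continuous_on:
  fixes W :: "'b::topological_space \<Rightarrow> 'a::real_normed_vector"
  assumes D: "frechet_derivs p U g D" and k: "length as < p"
    and W: "continuous_on I W" "\<And>x. x \<in> I \<Longrightarrow> W x \<in> U"
    and V: "\<And>a. a \<in> set as \<Longrightarrow> continuous_on I (V a)"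
  shows "continuous_on I (\<lambda>x. D (length as) (W x) (map (\<lambda>a. V a x) as))"
  unfolding continuous_on_def
proof (rule ballI, rule LIM_zero_cancel)
  fix x0 assume x0: "x0 \<in> I"
  let ?k = "length as" and ?F = "at x0 within I" and ?vs = "\<lambda>x. map (\<lambda>a. V a x) as"
  have bm: "bounded_multilinear j (D j (W x0))" if "j \<le> p" for j
    using D W(2)[OF x0] that by (auto simp: frechet_derivs_def)
  have bound: "\<exists>K\<ge>0. \<forall>vs. length vs = j \<longrightarrow> norm (D j (W x0) vs) \<le> K * prod_list (map norm vs)"
    if j: "j \<le> p" for j
  proof -
    obtain K where K: "\<And>vs. length vs = j \<Longrightarrow> norm (D j (W x0) vs) \<le> K * prod_list (map norm vs)"
      using bm[OF j] by (auto simp: bounded_multilinear_def)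
    have "norm (D j (W x0) vs) \<le> \<bar>K\<bar> * prod_list (map norm vs)" if "length vs = j" for vs
      using K[OF that] mult_right_mono[OF abs_ge_self prod_list_norm_nonneg[of vs]]
      by (rule order_trans)
    then show ?thesis by (intro exI[of _ "\<bar>K\<bar>"]) auto
  qed
  obtain K0 where K0: "K0 \<ge> 0"
    "\<And>vs. length vs = ?k \<Longrightarrow> norm (D ?k (W x0) vs) \<le> K0 * prod_list (map norm vs)"
    using bound[of ?k] k by auto
  obtain K1 where K1: "K1 \<ge> 0"
    "\<And>vs. length vs = Suc ?k \<Longrightarrow> norm (D (Suc ?k) (W x0) vs) \<le> K1 * prod_list (map norm vs)"
    using bound[of "Suc ?k"] k by auto
  obtain \<delta> where \<delta>: "\<delta> > 0" "\<And>v vs. norm v < \<delta> \<Longrightarrow> length vs = ?k \<Longrightarrow>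
      norm (D ?k (W x0 + v) vs - D ?k (W x0) vs - D (Suc ?k) (W x0) (v # vs))
        \<le> 1 * norm v * prod_list (map norm vs)"
    using frechet_derivs_differentiability[OF D k W(2)[OF x0] zero_less_one] by blast
  define R where "R = 1 + (\<Sum>a\<in>set as. norm (V a x0))"
  have R: "R \<ge> 0" unfolding R_def by (simp add: sum_nonneg add_nonneg_nonneg)
  define d where "d x = (\<Sum>a\<in>set as. norm (V a x - V a x0))" for x
  have d: "norm (V a x - V a x0) \<le> d x" if "a \<in> set as" for a x
    unfolding d_def using that by (intro member_le_sum) auto
  have d_nonneg: "d x \<ge> 0" for x by (simp add: d_def sum_nonneg)
  have lim_d: "(d \<longlongrightarrow> 0) ?F"
    unfolding d_def using V x0
    by (intro tendsto_null_sum tendsto_norm_zero LIM_zero) (auto simp: continuous_on_def)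
  have lim_W: "((\<lambda>x. norm (W x - W x0)) \<longlongrightarrow> 0) ?F"
    using W(1) x0 by (intro tendsto_norm_zero LIM_zero) (auto simp: continuous_on_def)
  have "\<forall>\<^sub>F x in ?F. norm (D ?k (W x) (?vs x) - D ?k (W x0) (?vs x0))
      \<le> (K1 + 1) * norm (W x - W x0) * R ^ ?k + K0 * ?k * R ^ (?k - 1) * d x"
    using order_tendstoD(2)[OF lim_d zero_less_one] order_tendstoD(2)[OF lim_W \<delta>(1)]
  proof eventually_elim
    case (elim x)
    have V0: "norm (V a x0) + 1 \<le> R" if "a \<in> set as" for a
      unfolding R_def using member_le_sum[of a "set as" "\<lambda>a. norm (V a x0)"] that by simp
    have Vx: "norm (V a x) \<le> R" if "a \<in> set as" for a
      using d[OF that, of x] V0[OF that] elim(1) norm_triangle_sub[of "V a x" "V a x0"] by linarith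
    let ?v = "W x - W x0" and ?P = "prod_list (map norm (?vs x))"
    have P: "?P \<le> R ^ ?k"
      using prod_list_norm_le_power[of "?vs x" R] Vx R by auto
    have "norm (D ?k (W x) (?vs x) - D ?k (W x0) (?vs x))
        \<le> norm (D (Suc ?k) (W x0) (?v # ?vs x)) + norm ?v * ?P"
      using \<delta>(2)[of ?v "?vs x"] elim(2) norm_triangle_sub
        [of "D ?k (W x) (?vs x) - D ?k (W x0) (?vs x)" "D (Suc ?k) (W x0) (?v # ?vs x)"]
      by simp
    also have "\<dots> \<le> (K1 + 1) * norm ?v * ?P"
      using K1(2)[of "?v # ?vs x"] by (simp add: algebra_simps)
    also have "\<dots> \<le> (K1 + 1) * norm ?v * R ^ ?k"
      using P K1(1) by (intro mult_left_mono) auto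
    finally have 1: "norm (D ?k (W x) (?vs x) - D ?k (W x0) (?vs x)) \<le> (K1 + 1) * norm ?v * R ^ ?k" .
    have "norm (D ?k (W x0) ([] @ ?vs x) - D ?k (W x0) ([] @ ?vs x0))
        \<le> K0 * length (?vs x) * R ^ (?k - 1) * d x"
    proof (rule multilinear_difference_bound)
      show "norm v \<le> R" if "v \<in> set [] \<union> set (?vs x) \<union> set (?vs x0)" for v
        using that Vx V0 by fastforce
      show "list_all2 (\<lambda>v v'. norm (v - v') \<le> d x) (?vs x) (?vs x0)"
        using d by (auto simp: list_all2_conv_all_nth)
    qed (use bm K0 R d_nonneg k in auto)
    then have 2: "norm (D ?k (W x0) (?vs x) - D ?k (W x0) (?vs x0)) \<le> K0 * ?k * R ^ (?k - 1) * d x"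
      by simp
    show ?case
      using norm_triangle_mono[OF 1 2] by simp
  qed
  moreover have "((\<lambda>x. (K1 + 1) * norm (W x - W x0) * R ^ ?k + K0 * ?k * R ^ (?k - 1) * d x) \<longlongrightarrow> 0) ?F"
    using tendsto_add[OF tendsto_mult_left_zero[OF tendsto_mult_right_zero[OF lim_W, of "K1 + 1"], of "R ^ ?k"]
        tendsto_mult_right_zero[OF lim_d, of "K0 * ?k * R ^ (?k - 1)"]] by simp
  ultimately show "((\<lambda>x. D ?k (W x) (?vs x) - D ?k (W x0) (?vs x0)) \<longlongrightarrow> 0) ?F"
    by (rule Lim_null_comparison)
qed

lemma frechet_taylor:
  assumes D: "frechet_derivs p U g D" and M: "derivs_bounded p U M D"
    and seg: "\<And>t. t \<in> {0..1} \<Longrightarrow> w + t *\<^sub>R v \<in> U"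
  shows "norm (g (w + v) - (\<Sum>k<p. (1 / fact k) *\<^sub>R D k w (replicate k v))) \<le> M p * norm v ^ p"
proof -
  define \<phi> where "\<phi> k t = D k (w + t *\<^sub>R v) (replicate k v)" for k and t :: real
  have "norm (\<phi> 0 1 - (\<Sum>k<p. (1 ^ k / fact k) *\<^sub>R \<phi> k 0)) \<le> M p * norm v ^ p"
  proof (rule taylor_remainder_bound)
    fix k and t :: real assume k: "k < p" and t: "t \<in> {0..1}"
    have "((\<lambda>t. w + t *\<^sub>R v) has_derivative (\<lambda>\<sigma>. \<sigma> *\<^sub>R v)) (at t within {0..1})"
      by (auto intro!: derivative_eq_intros)
    from has_derivative_compose[OF this frechet_derivs_has_derivative[OF D k seg[OF t], of "replicate k v"]]
    have "(\<phi> k has_derivative (\<lambda>\<sigma>. D (Suc k) (w + t *\<^sub>R v) (\<sigma> *\<^sub>R v # replicate k v))) (at t within {0..1})"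
      by (simp add: \<phi>_def[abs_def])
    moreover have "D (Suc k) (w + t *\<^sub>R v) (\<sigma> *\<^sub>R v # replicate k v) = \<sigma> *\<^sub>R \<phi> (Suc k) t" for \<sigma>
    proof -
      have "bounded_multilinear (Suc k) (D (Suc k) (w + t *\<^sub>R v))"
        using D k seg[OF t] by (auto simp: frechet_derivs_def)
      then have "linear (\<lambda>x. D (Suc k) (w + t *\<^sub>R v) ([] @ x # replicate k v))"
        by (rule bounded_multilinear_slot) simp
      from linear_scale[OF this, of \<sigma> v] show ?thesis by (simp add: \<phi>_def)
    qed
    ultimately show "(\<phi> k has_vector_derivative \<phi> (Suc k) t) (at t within {0..1})"
      by (simp add: has_vector_derivative_def)
  next
    fix t :: real assume "t \<in> {0..1}"
    then have "norm (\<phi> p t) \<le> M p * prod_list (map norm (replicate p v))"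
      unfolding \<phi>_def
      by (intro M[unfolded derivs_bounded_def, rule_format] seg) auto
    then show "norm (\<phi> p t) \<le> M p * norm v ^ p"
      by simp
  qed simp
  moreover have "D 0 (w + v) [] = g (w + v)"
    using D seg[of 1] by (auto simp: frechet_derivs_def)
  ultimately show ?thesis by (simp add: \<phi>_def)
qed

section \<open>The solution near the linear flow\<close>

lemma open_tube: "open (tube T r u)"
proof -
  have "tube T r u = (\<Union>t\<in>{0..T}. ball (u t) r)"
    by (auto simp: tube_def dist_norm norm_minus_commute)
  then show ?thesis by auto
qed

text \<open>One problem with an admissible step size.  The last condition keeps the segments from the linear
flow to the solution inside the tube.  For a nonnegative \<open>M\<close>, the bounds can be multiplied and
added freely.\<close>

locale mild_setting =
  fixes CF T r :: real and p :: nat and M :: "nat \<Rightarrow> real"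
    and S :: "real \<Rightarrow> 'a::banach \<Rightarrow>\<^sub>L 'a" and g :: "'a \<Rightarrow> 'a" and D :: "nat \<Rightarrow> 'a \<Rightarrow> 'a list \<Rightarrow> 'a"
    and u :: "real \<Rightarrow> 'a" and u0 :: 'a and h :: real
  assumes S_bound: "\<And>t. t \<ge> 0 \<Longrightarrow> norm (S t) \<le> CF"
    and S_continuous: "\<And>x. continuous_on {0..} (\<lambda>t. S t x)"
    and mild: "mild_solution T S g u0 u"
    and derivs: "frechet_derivs p (tube T r u) g D"
    and bounded: "derivs_bounded p (tube T r u) M D"
    and M_nonneg: "\<And>k. M k \<ge> 0"
    and h_pos: "h > 0" and h_le: "h \<le> T" "h \<le> 1" and h_small: "CF * M 0 * h < r"
begin

lemma CF_nonneg: "CF \<ge> 0"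
  using order_trans[OF norm_ge_zero S_bound[of 0]] by simp

lemma norm_S_le: "t \<ge> 0 \<Longrightarrow> norm (S t x) \<le> CF * norm x"
  using norm_blinfun[of "S t" x] mult_right_mono[OF S_bound norm_ge_zero] order_trans by blast

lemma r_pos: "r > 0"
proof -
  have "CF * M 0 * h \<ge> 0" using CF_nonneg M_nonneg[of 0] h_pos by simp
  then show ?thesis using h_small by simp
qed

lemma time_in: "\<eta> \<in> {0..1} \<Longrightarrow> \<eta> * h \<in> {0..T}"
  using h_pos h_le mult_mono[of \<eta> 1 h T] by auto

lemma D_bound:
  "k \<le> p \<Longrightarrow> w \<in> tube T r u \<Longrightarrow> length vs = k \<Longrightarrow> norm (D k w vs) \<le> M k * prod_list (map norm vs)"
  using bounded by (auto simp: derivs_bounded_def)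

lemma u_in_tube: "t \<in> {0..T} \<Longrightarrow> u t \<in> tube T r u"
  using r_pos by (auto simp: tube_def intro!: bexI[of _ t])

lemma norm_g_le: "t \<in> {0..T} \<Longrightarrow> norm (g (u t)) \<le> M 0"
  using D_bound[of 0 "u t" "[]"] u_in_tube derivs by (auto simp: frechet_derivs_def)

lemma norm_deviation_le:
  assumes t: "t \<in> {0..T}"
  shows "norm (u t - S t u0) \<le> CF * M 0 * t"
proof -
  let ?f = "\<lambda>s. S (t - s) (g (u s))"
  have f: "?f integrable_on {0..t}" "u t = S t u0 + integral {0..t} ?f"
    using mild t by (auto simp: mild_solution_def)
  have "norm (integral {0..t} ?f) \<le> CF * M 0 * t"
  proof (rule norm_integral_le[OF f(1)])
    show "norm (?f s) \<le> CF * M 0" if "s \<in> {0..t}" for s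
    proof -
      have "norm (?f s) \<le> CF * norm (g (u s))" using that by (intro norm_S_le) auto
      also have "\<dots> \<le> CF * M 0" using that t CF_nonneg by (intro mult_left_mono norm_g_le) auto
      finally show ?thesis .
    qed
  qed (use t in simp)
  then show ?thesis using f(2) t by simp
qed

lemma norm_deviation_le_h:
  assumes \<eta>: "\<eta> \<in> {0..1}"
  shows "norm (u (\<eta> * h) - S (\<eta> * h) u0) \<le> CF * M 0 * h"
proof -
  have "CF * M 0 * (\<eta> * h) \<le> CF * M 0 * h"
    using \<eta> h_pos CF_nonneg M_nonneg[of 0] by (intro mult_left_mono) (auto simp: mult_le_cancel_right2)
  then show ?thesis using norm_deviation_le[OF time_in[OF \<eta>]] by linarith
qed

lemma segment_in_tube:
  assumes \<eta>: "\<eta> \<in> {0..1}" and c: "c \<in> {0..1}"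
  shows "S (\<eta> * h) u0 + c *\<^sub>R (u (\<eta> * h) - S (\<eta> * h) u0) \<in> tube T r u"
proof -
  let ?e = "u (\<eta> * h) - S (\<eta> * h) u0"
  have "S (\<eta> * h) u0 + c *\<^sub>R ?e - u (\<eta> * h) = - ((1 - c) *\<^sub>R ?e)"
    by (simp add: algebra_simps)
  then have "norm (S (\<eta> * h) u0 + c *\<^sub>R ?e - u (\<eta> * h)) = (1 - c) * norm ?e"
    using c by (simp only: norm_minus_cancel norm_scaleR) simp
  also have "\<dots> \<le> norm ?e" using c by (simp add: mult_left_le_one_le)
  also have "\<dots> < r" using norm_deviation_le_h[OF \<eta>] h_small by simp
  finally show ?thesis using time_in[OF \<eta>] by (auto simp: tube_def)
qed

lemma linear_flow_in_tube: "\<eta> \<in> {0..1} \<Longrightarrow> S (\<eta> * h) u0 \<in> tube T r u"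
  using segment_in_tube[of \<eta> 0] by simp

text \<open>Strong continuity and uniform boundedness together give joint continuity.\<close>

lemma continuous_on_S:
  fixes a :: "'b::topological_space \<Rightarrow> real"
  assumes a: "continuous_on X a" "\<And>x. x \<in> X \<Longrightarrow> a x \<ge> 0" and b: "continuous_on X b"
  shows "continuous_on X (\<lambda>x. S (a x) (b x))"
  unfolding continuous_on_def
proof (rule ballI, rule LIM_zero_cancel)
  fix x0 assume x0: "x0 \<in> X"
  let ?F = "at x0 within X" and ?q = "\<lambda>x. S (a x) (b x0) - S (a x0) (b x0)"
  have "continuous_on X ((\<lambda>t. S t (b x0)) \<circ> a)"
    by (intro continuous_on_compose a continuous_on_subset[OF S_continuous]) (use a in auto)
  then have "((\<lambda>x. norm (?q x)) \<longlongrightarrow> 0) ?F"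
    using x0 by (intro tendsto_norm_zero LIM_zero) (auto simp: continuous_on_def)
  moreover have "((\<lambda>x. norm (b x - b x0)) \<longlongrightarrow> 0) ?F"
    using b x0 by (intro tendsto_norm_zero LIM_zero) (auto simp: continuous_on_def)
  ultimately have lim: "((\<lambda>x. CF * norm (b x - b x0) + norm (?q x)) \<longlongrightarrow> 0) ?F"
    using tendsto_add[OF tendsto_mult_right_zero[of _ _ CF]] by simp
  have "\<forall>\<^sub>F x in ?F. norm (S (a x) (b x) - S (a x0) (b x0)) \<le> CF * norm (b x - b x0) + norm (?q x)"
  proof -
    have "norm (S (a x) (b x) - S (a x0) (b x0)) \<le> CF * norm (b x - b x0) + norm (?q x)"
      if "x \<in> X" for x
    proof -
      have "S (a x) (b x) - S (a x0) (b x0) = S (a x) (b x - b x0) + ?q x"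
        by (simp add: blinfun.diff_right)
      also have "norm \<dots> \<le> norm (S (a x) (b x - b x0)) + norm (?q x)" by (rule norm_triangle_ineq)
      finally show ?thesis using norm_S_le[OF a(2)[OF that], of "b x - b x0"] by linarith
    qed
    then show ?thesis by (auto simp: eventually_at_filter)
  qed
  then show "((\<lambda>x. S (a x) (b x) - S (a x0) (b x0)) \<longlongrightarrow> 0) ?F"
    using lim by (rule Lim_null_comparison)
qed

end

section \<open>Elementary integrals\<close>

text \<open>A bound for \<open>elem_int S D h t \<zeta> u0\<close> with \<open>\<zeta> \<in> {0..1}\<close> that is uniform over all problems and step
sizes.\<close>

primrec elem_bound :: "real \<Rightarrow> (nat \<Rightarrow> real) \<Rightarrow> rtree \<Rightarrow> real" where
  "elem_bound CF M (Node ts) = CF * (M (size ts) * prod_mset (image_mset (elem_bound CF M) ts))"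

context mild_setting
begin

text \<open>The value to which the semigroup is applied in the integrand of \<open>Node m\<close>.\<close>

definition tree_deriv :: "rtree multiset \<Rightarrow> real \<Rightarrow> 'a" where
  "tree_deriv m \<eta> = apply_mset (D (size m) (S (\<eta> * h) u0)) (image_mset (\<lambda>t. elem_int S D h t \<eta> u0) m)"

lemma elem_int_Node:
  "elem_int S D h (Node m) \<zeta> u0 = integral {0..\<zeta>} (\<lambda>\<eta>. S ((\<zeta> - \<eta>) * h) (tree_deriv m \<eta>))"
  by (simp add: tree_deriv_def multiset.map_comp o_def)

text \<open>The choice of the order of the arguments in \<^const>\<open>apply_mset\<close> may vary with \<open>\<eta>\<close>.  Symmetry
replaces it by a fixed order, after which continuity in \<open>\<eta>\<close> makes sense.\<close>

lemma tree_deriv_list: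
  assumes "\<eta> \<in> {0..1}" "length ts \<le> p"
  shows "tree_deriv (mset ts) \<eta>
       = D (length ts) (S (\<eta> * h) u0) (map (\<lambda>t. elem_int S D h t \<eta> u0) ts)"
  using frechet_derivs_apply_mset[OF derivs open_tube, of "map (\<lambda>t. elem_int S D h t \<eta> u0) ts"]
    linear_flow_in_tube assms by (simp add: tree_deriv_def)

lemma norm_tree_deriv_le:
  assumes \<eta>: "\<eta> \<in> {0..1}" and m: "size m \<le> p"
    and t: "\<And>t. t \<in># m \<Longrightarrow> norm (elem_int S D h t \<eta> u0) \<le> elem_bound CF M t"
  shows "norm (tree_deriv m \<eta>) \<le> M (size m) * prod_mset (image_mset (elem_bound CF M) m)"
proof -
  obtain ts where ts: "mset ts = m" using ex_mset by blast
  have "norm (tree_deriv m \<eta>)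
      \<le> M (size m) * prod_list (map norm (map (\<lambda>t. elem_int S D h t \<eta> u0) ts))"
    using tree_deriv_list[OF \<eta>, of ts] m ts
      D_bound[of "size m" "S (\<eta> * h) u0" "map (\<lambda>t. elem_int S D h t \<eta> u0) ts"] linear_flow_in_tube[OF \<eta>]
    by auto
  also have "prod_list (map norm (map (\<lambda>t. elem_int S D h t \<eta> u0) ts)) \<le> prod_list (map (elem_bound CF M) ts)"
  proof -
    have "\<And>t. t \<in> set ts \<Longrightarrow> norm (elem_int S D h t \<eta> u0) \<le> elem_bound CF M t"
      using t ts by auto
    then show ?thesis
    proof (induction ts)
      case (Cons a ts)
      have a: "norm (elem_int S D h a \<eta> u0) \<le> elem_bound CF M a" using Cons.prems by simp
      show ?case
        using mult_mono[OF a Cons.IH order_trans[OF norm_ge_zero a] prod_list_norm_nonneg] Cons.prems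
        by simp
    qed simp
  qed
  also have "prod_list (map (elem_bound CF M) ts) = prod_mset (image_mset (elem_bound CF M) m)"
    using ts by (metis mset_map prod_mset_prod_list)
  finally show ?thesis using M_nonneg by (simp add: mult_left_mono)
qed

lemma convolution_integrable:
  assumes "continuous_on {0..1} f" "\<zeta> \<in> {0..1}"
  shows "(\<lambda>\<eta>. S ((\<zeta> - \<eta>) * h) (f \<eta>)) integrable_on {0..\<zeta>}"
  using assms h_pos
  by (intro integrable_continuous_real continuous_on_S continuous_intros continuous_on_subset[OF assms(1)]) auto

text \<open>As \<open>size m < p\<close>, the derivative that occurs in the integrand is itself differentiable, hence
continuous.\<close>

lemma elem_int_node_regularity:
  assumes m: "size m < p"
    and t: "\<And>t. t \<in># m \<Longrightarrow> continuous_on {0..1} (\<lambda>\<zeta>. elem_int S D h t \<zeta> u0)"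
      "\<And>t \<zeta>. t \<in># m \<Longrightarrow> \<zeta> \<in> {0..1} \<Longrightarrow> norm (elem_int S D h t \<zeta> u0) \<le> elem_bound CF M t"
  shows "continuous_on {0..1} (tree_deriv m)"
    and "continuous_on {0..1} (\<lambda>\<zeta>. elem_int S D h (Node m) \<zeta> u0)"
    and "\<zeta> \<in> {0..1} \<Longrightarrow> norm (elem_int S D h (Node m) \<zeta> u0) \<le> elem_bound CF M (Node m)"
proof -
  obtain ts where ts: "mset ts = m" using ex_mset by blast
  then have len: "length ts < p" using m by auto
  have flow: "continuous_on {0..1} (\<lambda>\<eta>. S (\<eta> * h) u0)"
    using h_pos by (intro continuous_on_S continuous_intros) auto
  have "continuous_on {0..1} (\<lambda>\<eta>. D (length ts) (S (\<eta> * h) u0) (map (\<lambda>t. elem_int S D h t \<eta> u0) ts))"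
    using t(1) ts by (intro frechet_derivs_continuous_on[OF derivs len flow linear_flow_in_tube]) auto
  then show tree: "continuous_on {0..1} (tree_deriv m)"
    by (rule continuous_on_eq) (use tree_deriv_list[of _ ts] len ts in auto)
  show "continuous_on {0..1} (\<lambda>\<zeta>. elem_int S D h (Node m) \<zeta> u0)"
    unfolding elem_int_Node
  proof (rule continuous_on_subinterval_integral)
    show "continuous_on {(\<zeta>, \<eta>). 0 \<le> \<eta> \<and> \<eta> \<le> \<zeta> \<and> \<zeta> \<le> 1} (\<lambda>(\<zeta>, \<eta>). S ((\<zeta> - \<eta>) * h) (tree_deriv m \<eta>))"
      unfolding case_prod_unfold
    proof (rule continuous_on_S)
      show "continuous_on {x. 0 \<le> snd x \<and> snd x \<le> fst x \<and> fst x \<le> 1} (\<lambda>x. tree_deriv m (snd x))"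
        by (rule continuous_on_compose2[OF tree]) (auto intro!: continuous_intros)
    qed (use h_pos in \<open>auto intro!: continuous_intros\<close>)
  qed
  show "norm (elem_int S D h (Node m) \<zeta> u0) \<le> elem_bound CF M (Node m)" if \<zeta>: "\<zeta> \<in> {0..1}"
  proof -
    let ?B = "elem_bound CF M (Node m)" and ?f = "\<lambda>\<eta>. S ((\<zeta> - \<eta>) * h) (tree_deriv m \<eta>)"
    have f: "norm (?f \<eta>) \<le> ?B" if \<eta>: "\<eta> \<in> {0..\<zeta>}" for \<eta>
    proof -
      have "norm (?f \<eta>) \<le> CF * norm (tree_deriv m \<eta>)" using \<eta> h_pos by (intro norm_S_le) auto
      also have "\<dots> \<le> ?B"
        using \<eta> \<zeta> m t(2) CF_nonneg by (simp, intro mult_left_mono norm_tree_deriv_le) auto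
      finally show ?thesis .
    qed
    have B: "?B \<ge> 0" using order_trans[OF norm_ge_zero f[of 0]] \<zeta> by simp
    have "norm (integral {0..\<zeta>} ?f) \<le> ?B * \<zeta>"
      using \<zeta> f by (intro norm_integral_le convolution_integrable[OF tree]) auto
    also have "\<dots> \<le> ?B" using B \<zeta> by (simp add: mult_left_le)
    finally show ?thesis by (simp only: elem_int_Node)
  qed
qed

lemma elem_int_regularity:
  assumes "nodes t \<le> p"
  shows "continuous_on {0..1} (\<lambda>\<zeta>. elem_int S D h t \<zeta> u0)"
    and "\<zeta> \<in> {0..1} \<Longrightarrow> norm (elem_int S D h t \<zeta> u0) \<le> elem_bound CF M t"
proof -
  have "continuous_on {0..1} (\<lambda>\<zeta>. elem_int S D h t \<zeta> u0) \<and>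
      (\<forall>\<zeta>\<in>{0..1}. norm (elem_int S D h t \<zeta> u0) \<le> elem_bound CF M t)"
    using assms
  proof (induction t)
    case (Node m)
    have "size m < p" using size_le_sum_nodes[of m] Node.prems by simp
    moreover have "nodes t \<le> p" if "t \<in># m" for t
      using nodes_le_sum_nodes[OF that] Node.prems by simp
    ultimately show ?case
      using Node.IH by (intro conjI ballI elem_int_node_regularity) auto
  qed
  then show "continuous_on {0..1} (\<lambda>\<zeta>. elem_int S D h t \<zeta> u0)"
    and "\<zeta> \<in> {0..1} \<Longrightarrow> norm (elem_int S D h t \<zeta> u0) \<le> elem_bound CF M t" by auto
qed

end

section \<open>Gaining one power of the step size\<close>

text \<open>The factors of \<open>h ^ Suc q\<close> in three errors: the Taylor remainder, the replacement of the
exact increment by the tree sum with error constant \<open>C\<close>, and the omitted forests.\<close>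

definition nonlinearity_const :: "real \<Rightarrow> (nat \<Rightarrow> real) \<Rightarrow> nat \<Rightarrow> real \<Rightarrow> real" where
  "nonlinearity_const CF M q C =
     M (Suc q) * (CF * M 0) ^ Suc q
   + (\<Sum>k<Suc q. M k * k * (CF * M 0 + C) ^ (k - 1) * C)
   + (\<Sum>m\<in>product_forests q. M (size m) * prod_mset (image_mset (elem_bound CF M) m))"

text \<open>The induction step: from an approximation by the trees with at most \<open>q\<close> nodes to one by the trees
with at most \<open>Suc q\<close> nodes.\<close>

locale mild_setting_step = mild_setting CF T r "Suc q" M S g D u u0 h
  for CF T r :: real and q :: nat and M S g D u u0 h +
  fixes C :: real
  assumes C_nonneg: "C \<ge> 0"
    and approx: "\<And>\<eta>. \<eta> \<in> {0..1} \<Longrightarrow>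
      norm (u (\<eta> * h) - (S (\<eta> * h) u0 + B_sum q S D h u0 \<eta>)) \<le> C * h ^ Suc q"
begin

lemma regularity_upto:
  assumes "t \<in> trees_upto q"
  shows "continuous_on {0..1} (\<lambda>\<zeta>. elem_int S D h t \<zeta> u0)"
    and "\<zeta> \<in> {0..1} \<Longrightarrow> norm (elem_int S D h t \<zeta> u0) \<le> elem_bound CF M t"
  using elem_int_regularity[of t] assms by (auto simp: trees_upto_def)

lemma product_forests_D:
  assumes "m \<in> product_forests q"
  shows "size m \<le> q" "\<And>t. t \<in># m \<Longrightarrow> t \<in> trees_upto q"
  using assms by (auto simp: product_forests_def multisets_of_size_def)

lemma tree_deriv_continuous: "m \<in> product_forests q \<Longrightarrow> continuous_on {0..1} (tree_deriv m)"
  using product_forests_D[of m] regularity_upto by (intro elem_int_node_regularity) auto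

definition coef :: "rtree multiset \<Rightarrow> real" where
  "coef m = h ^ (nodes (Node m) - 1) / symcoef (Node m)"

definition integrand :: "real \<Rightarrow> 'a" where
  "integrand \<eta> = (\<Sum>m\<in>forests_upto q. coef m *\<^sub>R tree_deriv m \<eta>)"

text \<open>The increment from the linear flow to the solution is \<open>O(h)\<close>, since only the integral term
separates them.\<close>

lemma taylor_error:
  assumes \<eta>: "\<eta> \<in> {0..1}"
  defines "w \<equiv> S (\<eta> * h) u0" and "e \<equiv> u (\<eta> * h) - S (\<eta> * h) u0"
  shows "norm (g (u (\<eta> * h)) - (\<Sum>k<Suc q. (1 / fact k) *\<^sub>R D k w (replicate k e)))
    \<le> M (Suc q) * (CF * M 0) ^ Suc q * h ^ Suc q"
proof -
  have "norm (g (w + e) - (\<Sum>k<Suc q. (1 / fact k) *\<^sub>R D k w (replicate k e)))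
      \<le> M (Suc q) * norm e ^ Suc q"
    unfolding w_def e_def using segment_in_tube[OF \<eta>] by (intro frechet_taylor[OF derivs bounded]) auto
  also have "\<dots> \<le> M (Suc q) * (CF * M 0 * h) ^ Suc q"
    using norm_deviation_le_h[OF \<eta>] M_nonneg unfolding e_def by (intro mult_left_mono power_mono) auto
  also have "\<dots> = M (Suc q) * (CF * M 0) ^ Suc q * h ^ Suc q"
    by (simp only: power_mult_distrib mult.assoc)
  finally show ?thesis by (simp add: w_def e_def)
qed

text \<open>Here the inductive approximation enters.  As \<open>h \<le> 1\<close>, the increment is at most \<open>CF * M 0\<close> and the
tree sum at most \<open>CF * M 0 + C\<close> in norm.\<close>

lemma substitution_error:
  assumes \<eta>: "\<eta> \<in> {0..1}" and k: "k < Suc q"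
  defines "w \<equiv> S (\<eta> * h) u0" and "e \<equiv> u (\<eta> * h) - S (\<eta> * h) u0" and "b \<equiv> B_sum q S D h u0 \<eta>"
  shows "norm ((1 / fact k) *\<^sub>R D k w (replicate k e) - (1 / fact k) *\<^sub>R D k w (replicate k b))
    \<le> M k * k * (CF * M 0 + C) ^ (k - 1) * C * h ^ Suc q"
proof -
  let ?R = "CF * M 0 + C"
  have w: "w \<in> tube T r u" unfolding w_def by (rule linear_flow_in_tube[OF \<eta>])
  have L: "bounded_multilinear k (D k w)" using derivs w k by (auto simp: frechet_derivs_def)
  have eb: "norm (e - b) \<le> C * h ^ Suc q"
    using approx[OF \<eta>] by (simp add: e_def b_def diff_diff_eq)
  have hq: "0 \<le> h ^ Suc q" "h ^ Suc q \<le> 1"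
    using h_pos h_le by (auto intro!: zero_le_power power_le_one simp del: power_Suc)
  have "norm e \<le> CF * M 0 * h" using norm_deviation_le_h[OF \<eta>] by (simp add: e_def)
  also have "\<dots> \<le> CF * M 0" using h_le h_pos CF_nonneg M_nonneg[of 0] by (simp add: mult_left_le)
  finally have e: "norm e \<le> CF * M 0" .
  have "C * h ^ Suc q \<le> C" using hq C_nonneg by (simp add: mult_left_le del: power_Suc)
  then have b: "norm b \<le> ?R" using e eb norm_triangle_sub[of b e] by (simp add: norm_minus_commute)
  have R: "?R \<ge> 0" using b norm_ge_zero order_trans by blast
  have "norm (D k w ([] @ replicate k e) - D k w ([] @ replicate k b))
      \<le> M k * length (replicate k e) * ?R ^ (k - 1) * (C * h ^ Suc q)"
  proof (rule multilinear_difference_bound[OF L])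
    show "norm (D k w vs) \<le> M k * prod_list (map norm vs)" if "length vs = k" for vs
      using D_bound w k that by simp
    show "norm v \<le> ?R" if "v \<in> set [] \<union> set (replicate k e) \<union> set (replicate k b)" for v
      using that e b C_nonneg by (auto simp: set_replicate_conv_if split: if_splits)
    show "list_all2 (\<lambda>v v'. norm (v - v') \<le> C * h ^ Suc q) (replicate k e) (replicate k b)"
      using eb by (auto simp: list_all2_conv_all_nth)
    show "0 \<le> C * h ^ Suc q" using C_nonneg hq by (simp del: power_Suc)
  qed (use M_nonneg R in auto)
  then have 1: "norm (D k w (replicate k e) - D k w (replicate k b))
      \<le> M k * k * ?R ^ (k - 1) * C * h ^ Suc q"
    by (simp add: mult.assoc)
  have "norm ((1 / fact k) *\<^sub>R D k w (replicate k e) - (1 / fact k) *\<^sub>R D k w (replicate k b))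
      = (1 / fact k) * norm (D k w (replicate k e) - D k w (replicate k b))"
    by (simp flip: scaleR_diff_right)
  also have "\<dots> \<le> norm (D k w (replicate k e) - D k w (replicate k b))"
    by (intro mult_left_le_one_le) (auto simp: fact_ge_1)
  finally show ?thesis using 1 by linarith
qed

lemma tree_expansion:
  assumes \<eta>: "\<eta> \<in> {0..1}"
  defines "w \<equiv> S (\<eta> * h) u0" and "b \<equiv> B_sum q S D h u0 \<eta>"
  shows "(\<Sum>k<Suc q. (1 / fact k) *\<^sub>R D k w (replicate k b))
    = (\<Sum>m\<in>product_forests q. coef m *\<^sub>R tree_deriv m \<eta>)"
proof -
  have w: "w \<in> tube T r u" unfolding w_def by (rule linear_flow_in_tube[OF \<eta>])
  have "(1 / fact k) *\<^sub>R D k w (replicate k b)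
      = (\<Sum>m\<in>multisets_of_size (trees_upto q) k. coef m *\<^sub>R tree_deriv m \<eta>)" if k: "k < Suc q" for k
  proof -
    have L: "bounded_multilinear k (D k w)" using derivs w k by (auto simp: frechet_derivs_def)
    have "apply_mset (D k w) (mset vs) = D k w vs" if "length vs = k" for vs
      using frechet_derivs_apply_mset[OF derivs open_tube, of vs w] w k that by auto
    from multilinear_tree_sum[OF L finite_trees_upto this, of h "\<lambda>t. elem_int S D h t \<eta> u0" q]
    have "(1 / fact k) *\<^sub>R D k w (replicate k b) = (\<Sum>m\<in>multisets_of_size (trees_upto q) k.
        coef m *\<^sub>R apply_mset (D k w) (image_mset (\<lambda>t. elem_int S D h t \<eta> u0) m))"
      unfolding b_def B_sum_def coef_def by blast
    also have "\<dots> = (\<Sum>m\<in>multisets_of_size (trees_upto q) k. coef m *\<^sub>R tree_deriv m \<eta>)"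
      by (intro sum.cong refl) (auto simp: tree_deriv_def w_def multisets_of_size_def)
    finally show ?thesis .
  qed
  then have "(\<Sum>k<Suc q. (1 / fact k) *\<^sub>R D k w (replicate k b))
      = (\<Sum>k<Suc q. \<Sum>m\<in>multisets_of_size (trees_upto q) k. coef m *\<^sub>R tree_deriv m \<eta>)"
    by (intro sum.cong) auto
  also have "\<dots> = (\<Sum>m\<in>product_forests q. coef m *\<^sub>R tree_deriv m \<eta>)"
    unfolding product_forests_def
    by (rule sum.UNION_disjoint[symmetric])
      (use finite_multisets_of_size[OF finite_trees_upto, of q] in \<open>auto simp: multisets_of_size_def\<close>)
  finally show ?thesis .
qed

lemma truncation_error:
  assumes \<eta>: "\<eta> \<in> {0..1}"
  shows "norm ((\<Sum>m\<in>product_forests q. coef m *\<^sub>R tree_deriv m \<eta>) - integrand \<eta>)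
    \<le> (\<Sum>m\<in>product_forests q. M (size m) * prod_mset (image_mset (elem_bound CF M) m)) * h ^ Suc q"
proof -
  let ?P = "product_forests q" and ?c = "\<lambda>m. M (size m) * prod_mset (image_mset (elem_bound CF M) m)"
  have tree: "norm (tree_deriv m \<eta>) \<le> ?c m" if m: "m \<in> ?P" for m
    using product_forests_D[OF m] regularity_upto \<eta> by (intro norm_tree_deriv_le) auto
  have "(\<Sum>m\<in>?P. coef m *\<^sub>R tree_deriv m \<eta>) - integrand \<eta>
      = (\<Sum>m\<in>?P - forests_upto q. coef m *\<^sub>R tree_deriv m \<eta>)"
    unfolding integrand_def
    using sum.subset_diff[OF forests_upto_subset finite_product_forests,
        where g = "\<lambda>m. coef m *\<^sub>R tree_deriv m \<eta>"] by simp
  also have "norm \<dots> \<le> (\<Sum>m\<in>?P - forests_upto q. ?c m * h ^ Suc q)"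
  proof (rule sum_norm_le)
    fix m assume m: "m \<in> ?P - forests_upto q"
    have "1 \<le> real (symcoef (Node m))" using symcoef_pos[of "Node m"] by linarith
    then have "coef m \<le> h ^ (nodes (Node m) - 1) / 1"
      using h_pos unfolding coef_def by (intro divide_left_mono) auto
    also have "\<dots> = h ^ (nodes (Node m) - 1)" by (rule div_by_1)
    also have "\<dots> \<le> h ^ Suc q"
      using m h_pos h_le by (intro power_decreasing) (auto simp: forests_upto_def)
    finally have "coef m \<le> h ^ Suc q" .
    moreover have "coef m \<ge> 0"
      unfolding coef_def using h_pos by (intro divide_nonneg_nonneg zero_le_power of_nat_0_le_iff) auto
    ultimately have "coef m * norm (tree_deriv m \<eta>) \<le> h ^ Suc q * ?c m"
      using m h_pos by (intro mult_mono tree) auto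
    then show "norm (coef m *\<^sub>R tree_deriv m \<eta>) \<le> ?c m * h ^ Suc q"
      using \<open>coef m \<ge> 0\<close> by (simp only: norm_scaleR abs_of_nonneg mult.commute)
  qed
  also have "\<dots> \<le> (\<Sum>m\<in>?P. ?c m * h ^ Suc q)"
  proof (rule sum_mono2[OF finite_product_forests])
    show "0 \<le> ?c m * h ^ Suc q" if "m \<in> ?P - (?P - forests_upto q)" for m
      using order_trans[OF norm_ge_zero tree[of m]] that h_pos
      by (intro mult_nonneg_nonneg[of "?c m"] zero_le_power) auto
  qed auto
  finally show ?thesis by (simp only: sum_distrib_right)
qed

lemma nonlinearity_error:
  assumes \<eta>: "\<eta> \<in> {0..1}"
  shows "norm (g (u (\<eta> * h)) - integrand \<eta>) \<le> nonlinearity_const CF M q C * h ^ Suc q"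
proof -
  let ?w = "S (\<eta> * h) u0"
  let ?te = "\<Sum>k<Suc q. (1 / fact k) *\<^sub>R D k ?w (replicate k (u (\<eta> * h) - ?w))"
  let ?tb = "\<Sum>k<Suc q. (1 / fact k) *\<^sub>R D k ?w (replicate k (B_sum q S D h u0 \<eta>))"
  have "norm (?te - ?tb) \<le> (\<Sum>k<Suc q. M k * k * (CF * M 0 + C) ^ (k - 1) * C * h ^ Suc q)"
    unfolding sum_subtractf[symmetric]
    by (rule sum_norm_le, rule substitution_error[OF \<eta>]) simp
  then have "norm (?te - ?tb) \<le> (\<Sum>k<Suc q. M k * k * (CF * M 0 + C) ^ (k - 1) * C) * h ^ Suc q"
    by (simp only: sum_distrib_right)
  note substitution = this
  have truncation: "norm (?tb - integrand \<eta>)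
      \<le> (\<Sum>m\<in>product_forests q. M (size m) * prod_mset (image_mset (elem_bound CF M) m)) * h ^ Suc q"
    unfolding tree_expansion[OF \<eta>] by (rule truncation_error[OF \<eta>])
  have "norm (g (u (\<eta> * h)) - integrand \<eta>)
      = norm ((g (u (\<eta> * h)) - ?te) + (?te - ?tb) + (?tb - integrand \<eta>))"
    by (simp only: diff_add_cancel add_diff_eq)
  also have "\<dots> \<le> norm (g (u (\<eta> * h)) - ?te) + norm (?te - ?tb) + norm (?tb - integrand \<eta>)"
    by (rule norm_triangle_le[OF add_right_mono[OF norm_triangle_ineq]])
  also have "\<dots> \<le> nonlinearity_const CF M q C * h ^ Suc q"
    unfolding nonlinearity_const_def distrib_right[of _ _ "h ^ Suc q"]
    by (rule add_mono[OF add_mono[OF taylor_error[OF \<eta>] substitution] truncation])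
  finally show ?thesis .
qed

lemma integrand_integrable:
  assumes "\<zeta> \<in> {0..1}"
  shows "(\<lambda>\<eta>. S ((\<zeta> - \<eta>) * h) (integrand \<eta>)) integrable_on {0..\<zeta>}"
proof (rule convolution_integrable[OF _ assms])
  show "continuous_on {0..1} integrand"
    unfolding integrand_def[abs_def]
  proof (intro continuous_on_sum continuous_on_scaleR continuous_on_const)
    fix m assume "m \<in> forests_upto q"
    then show "continuous_on {0..1} (tree_deriv m)"
      using forests_upto_subset by (intro tree_deriv_continuous) auto
  qed
qed

text \<open>The forests with at most \<open>q\<close> nodes are exactly the branches of the trees with at most \<open>Suc q\<close> nodes;
the factor \<open>h\<close> belongs to the root.\<close>

lemma B_sum_Suc_eq_integral:
  assumes \<zeta>: "\<zeta> \<in> {0..1}"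
  shows "B_sum (Suc q) S D h u0 \<zeta> = h *\<^sub>R integral {0..\<zeta>} (\<lambda>\<eta>. S ((\<zeta> - \<eta>) * h) (integrand \<eta>))"
proof -
  let ?f = "\<lambda>m \<eta>. S ((\<zeta> - \<eta>) * h) (tree_deriv m \<eta>)"
  have fin: "finite (forests_upto q)"
    using forests_upto_subset finite_product_forests finite_subset by blast
  have f: "?f m integrable_on {0..\<zeta>}" if "m \<in> forests_upto q" for m
    using that forests_upto_subset tree_deriv_continuous by (intro convolution_integrable \<zeta>) auto
  have "integral {0..\<zeta>} (\<lambda>\<eta>. S ((\<zeta> - \<eta>) * h) (integrand \<eta>))
      = integral {0..\<zeta>} (\<lambda>\<eta>. \<Sum>m\<in>forests_upto q. coef m *\<^sub>R ?f m \<eta>)"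
    by (simp add: integrand_def blinfun.sum_right blinfun.scaleR_right)
  also have "\<dots> = (\<Sum>m\<in>forests_upto q. coef m *\<^sub>R integral {0..\<zeta>} (?f m))"
    using fin f by (subst integral_sum) (auto intro: integrable_cmul)
  finally have "h *\<^sub>R integral {0..\<zeta>} (\<lambda>\<eta>. S ((\<zeta> - \<eta>) * h) (integrand \<eta>))
      = (\<Sum>m\<in>forests_upto q. (h ^ nodes (Node m) / symcoef (Node m)) *\<^sub>R elem_int S D h (Node m) \<zeta> u0)"
    by (simp add: scaleR_sum_right elem_int_Node coef_def del: elem_int.simps)
  also have "\<dots> = B_sum (Suc q) S D h u0 \<zeta>"
    unfolding B_sum_def trees_upto_Suc by (subst sum.reindex) (auto simp: inj_on_def)
  finally show ?thesis by simp
qed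

lemma rescaled_mild_solution:
  assumes \<zeta>: "\<zeta> \<in> {0..1}"
  defines "f \<equiv> \<lambda>\<eta>. S ((\<zeta> - \<eta>) * h) (g (u (\<eta> * h)))"
  shows "f integrable_on {0..\<zeta>}" and "u (\<zeta> * h) = S (\<zeta> * h) u0 + h *\<^sub>R integral {0..\<zeta>} f"
proof -
  let ?k = "\<lambda>s. S (\<zeta> * h - s) (g (u s))"
  have k: "?k integrable_on {0..\<zeta> * h}" "u (\<zeta> * h) = S (\<zeta> * h) u0 + integral {0..\<zeta> * h} ?k"
    using mild time_in[OF \<zeta>] by (auto simp: mild_solution_def)
  have "((\<lambda>\<eta>. ?k (h * \<eta>)) has_integral (1 / \<bar>h\<bar>) *\<^sub>R integral {0..\<zeta> * h} ?k) ((\<lambda>x. x / h) ` {0..\<zeta> * h})"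
    using h_pos by (intro has_integral_stretch_real integrable_integral k) auto
  then have f: "(f has_integral (1 / h) *\<^sub>R integral {0..\<zeta> * h} ?k) {0..\<zeta>}"
    using h_pos \<zeta> by (simp add: f_def image_divide_atLeastAtMost algebra_simps)
  show "f integrable_on {0..\<zeta>}" using f by blast
  show "u (\<zeta> * h) = S (\<zeta> * h) u0 + h *\<^sub>R integral {0..\<zeta>} f"
    using k(2) integral_unique[OF f] h_pos by simp
qed

text \<open>Both integrands, that of the mild solution and the continuous tree sum, are integrable, so their
difference is; the factor \<open>h\<close> in front of the integral raises the order by one.\<close>

lemma next_approx:
  assumes \<zeta>: "\<zeta> \<in> {0..1}"
  shows "norm (u (\<zeta> * h) - (S (\<zeta> * h) u0 + B_sum (Suc q) S D h u0 \<zeta>))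
    \<le> CF * nonlinearity_const CF M q C * h ^ Suc (Suc q)"
proof -
  let ?K = "CF * (nonlinearity_const CF M q C * h ^ Suc q)"
  let ?G = "\<lambda>\<eta>. S ((\<zeta> - \<eta>) * h) (g (u (\<eta> * h)))"
  let ?I = "\<lambda>\<eta>. S ((\<zeta> - \<eta>) * h) (integrand \<eta>)"
  note G = rescaled_mild_solution[OF \<zeta>]
  have "u (\<zeta> * h) - (S (\<zeta> * h) u0 + B_sum (Suc q) S D h u0 \<zeta>)
      = h *\<^sub>R integral {0..\<zeta>} (\<lambda>\<eta>. ?G \<eta> - ?I \<eta>)"
    unfolding G(2) B_sum_Suc_eq_integral[OF \<zeta>] integral_diff[OF G(1) integrand_integrable[OF \<zeta>]]
    by (simp add: scaleR_diff_right)
  moreover have "norm (integral {0..\<zeta>} (\<lambda>\<eta>. ?G \<eta> - ?I \<eta>)) \<le> ?K * \<zeta>"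
  proof (rule norm_integral_le)
    show "(\<lambda>\<eta>. ?G \<eta> - ?I \<eta>) integrable_on {0..\<zeta>}"
      using G(1) integrand_integrable[OF \<zeta>] by (rule integrable_diff)
    show "norm (?G \<eta> - ?I \<eta>) \<le> ?K" if \<eta>: "\<eta> \<in> {0..\<zeta>}" for \<eta>
    proof -
      have "norm (?G \<eta> - ?I \<eta>) \<le> CF * norm (g (u (\<eta> * h)) - integrand \<eta>)"
        using \<eta> h_pos unfolding blinfun.diff_right[symmetric] by (intro norm_S_le) auto
      also have "\<dots> \<le> ?K" using \<eta> \<zeta> CF_nonneg by (intro mult_left_mono nonlinearity_error) auto
      finally show ?thesis .
    qed
  qed (use \<zeta> in simp)
  moreover have "?K * \<zeta> \<le> ?K"
  proof (rule mult_left_le)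
    have "nonlinearity_const CF M q C * h ^ Suc q \<ge> 0"
      by (rule order_trans[OF norm_ge_zero nonlinearity_error[of 0]]) simp
    then show "0 \<le> ?K" using CF_nonneg by simp
  qed (use \<zeta> in simp)
  ultimately have "norm (u (\<zeta> * h) - (S (\<zeta> * h) u0 + B_sum (Suc q) S D h u0 \<zeta>)) \<le> h * ?K"
    using h_pos by (simp only: norm_scaleR abs_of_pos) (intro mult_left_mono, auto)
  also have "h * ?K = CF * nonlinearity_const CF M q C * h ^ Suc (Suc q)"
    by (simp only: power_Suc mult_ac)
  finally show ?thesis .
qed

end

section \<open>Uniform error bound for every order\<close>

lemma frechet_derivs_Suc: "frechet_derivs (Suc p) U g D \<Longrightarrow> frechet_derivs p U g D"
  by (auto simp: frechet_derivs_def)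

lemma derivs_bounded_Suc: "derivs_bounded (Suc p) U M D \<Longrightarrow> derivs_bounded p U M D"
  by (auto simp: derivs_bounded_def)

text \<open>The constant is chosen before the problem and the step size: it is obtained by iterating
\<^const>\<open>nonlinearity_const\<close>, whose arguments besides the previous constant are \<open>CF\<close>, \<open>M\<close> and the
order.\<close>

lemma B_series_error:
  "\<exists>C\<ge>0. \<forall>(S :: real \<Rightarrow> 'a::banach \<Rightarrow>\<^sub>L 'a) g D u u0 h \<zeta>.
     mild_setting CF T r p M S g D u u0 h \<longrightarrow> \<zeta> \<in> {0..1} \<longrightarrow>
     norm (u (\<zeta> * h) - (S (\<zeta> * h) u0 + B_sum p S D h u0 \<zeta>)) \<le> C * h ^ Suc p"
proof (induction p)
  case 0
  have "norm (u (\<zeta> * h) - (S (\<zeta> * h) u0 + B_sum 0 S D h u0 \<zeta>)) \<le> \<bar>CF * M 0\<bar> * h ^ Suc 0"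
    if s: "mild_setting CF T r 0 M S g D u u0 h" and \<zeta>: "\<zeta> \<in> {0..1}"
    for S :: "real \<Rightarrow> 'a \<Rightarrow>\<^sub>L 'a" and g D u u0 h \<zeta>
  proof -
    interpret mild_setting CF T r 0 M S g D u u0 h by (rule s)
    have "trees_upto 0 = {}" using nodes_pos by (auto simp: trees_upto_def)
    then have "B_sum 0 S D h u0 \<zeta> = 0" by (simp add: B_sum_def)
    then show ?thesis
      using norm_deviation_le_h[OF \<zeta>] CF_nonneg M_nonneg[of 0] by (simp add: abs_mult)
  qed
  then show ?case by (intro exI[of _ "\<bar>CF * M 0\<bar>"]) auto
next
  case (Suc p)
  then obtain C where C: "C \<ge> 0" and bound: "\<And>(S :: real \<Rightarrow> 'a \<Rightarrow>\<^sub>L 'a) g D u u0 h \<zeta>.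
      mild_setting CF T r p M S g D u u0 h \<Longrightarrow> \<zeta> \<in> {0..1} \<Longrightarrow>
      norm (u (\<zeta> * h) - (S (\<zeta> * h) u0 + B_sum p S D h u0 \<zeta>)) \<le> C * h ^ Suc p"
    by blast
  define C' where "C' = CF * nonlinearity_const CF M p C"
  have "norm (u (\<zeta> * h) - (S (\<zeta> * h) u0 + B_sum (Suc p) S D h u0 \<zeta>)) \<le> \<bar>C'\<bar> * h ^ Suc (Suc p)"
    if s: "mild_setting CF T r (Suc p) M S g D u u0 h" and \<zeta>: "\<zeta> \<in> {0..1}"
    for S :: "real \<Rightarrow> 'a \<Rightarrow>\<^sub>L 'a" and g D u u0 h \<zeta>
  proof -
    interpret mild_setting CF T r "Suc p" M S g D u u0 h by (rule s)
    have "mild_setting CF T r p M S g D u u0 h"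
      using S_bound S_continuous mild frechet_derivs_Suc[OF derivs] derivs_bounded_Suc[OF bounded]
        M_nonneg h_pos h_le h_small by unfold_locales
    then interpret mild_setting_step CF T r p M S g D u u0 h C
      using C bound by unfold_locales auto
    have "C' * h ^ Suc (Suc p) \<le> \<bar>C'\<bar> * h ^ Suc (Suc p)"
      using h_pos by (intro mult_right_mono) auto
    then show ?thesis using next_approx[OF \<zeta>] by (simp add: C'_def del: power_Suc)
  qed
  then show ?case by (intro exI[of _ "\<bar>C'\<bar>"]) auto
qed

lemma exp_familyD:
  assumes "exp_family CF F E" "A \<in> F"
  shows "t \<ge> 0 \<Longrightarrow> norm (E A t) \<le> CF" and "continuous_on {0..} (\<lambda>t. E A t x)"
proof -
  consider "C0_group (E A)" "\<forall>t. norm (E A t) \<le> CF" | "C0_semigroup (E A)" "\<forall>t\<ge>0. norm (E A t) \<le> CF"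
    using assms by (auto simp: exp_family_def group_generated_by_def semigroup_generated_by_def)
  then have "(\<forall>t\<ge>0. norm (E A t) \<le> CF) \<and> continuous_on {0..} (\<lambda>t. E A t x)"
  proof cases
    case 1
    then have "continuous_on UNIV (\<lambda>t. E A t x)" by (simp add: C0_group_def)
    then show ?thesis using 1(2) continuous_on_subset by blast
  qed (simp add: C0_semigroup_def)
  then show "t \<ge> 0 \<Longrightarrow> norm (E A t) \<le> CF" and "continuous_on {0..} (\<lambda>t. E A t x)" by auto
qed

theorem theorem3p5:
  fixes CF T r :: real and p :: nat and M :: "nat \<Rightarrow> real"
  assumes "T > 0" and "r > 0"
  shows "\<exists>C>0. \<exists>h0>0. h0 \<le> T \<and>
    (\<forall>(F :: ('a::banach \<rightharpoonup> 'a) set) E A g D u u0.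
        exp_family CF F E \<longrightarrow> A \<in> F \<longrightarrow>
        mild_solution T (E A) g u0 u \<longrightarrow>
        frechet_derivs p (tube T r u) g D \<longrightarrow>
        derivs_bounded p (tube T r u) M D \<longrightarrow>
        (\<forall>h \<zeta>. 0 < h \<and> h \<le> h0 \<and> 0 \<le> \<zeta> \<and> \<zeta> \<le> 1 \<longrightarrow>
           norm (u (\<zeta> * h)
                 - (blinfun_apply (E A (\<zeta> * h)) u0 + B_sum p (E A) D h u0 \<zeta>))
             \<le> C * h ^ (p + 1)))"
proof -
  \<comment> \<open>\<open>M k\<close> may be negative, for instance when the space is trivial and \<open>k > 0\<close>.\<close>
  let ?M = "\<lambda>k. \<bar>M k\<bar>"
  define K where "K = \<bar>CF\<bar> * \<bar>M 0\<bar>"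
  have K: "K \<ge> 0" by (simp add: K_def)
  \<comment> \<open>The bound \<open>1\<close> lets higher powers of the step size be absorbed into lower ones; the last
    bound gives \<open>K * h0 < r\<close> even when \<open>K = 0\<close>.\<close>
  define h0 where "h0 = min (min T 1) (r / (K + 1))"
  have h0: "h0 > 0" "h0 \<le> T" "h0 \<le> 1" "K * h0 < r"
  proof -
    show "h0 > 0" "h0 \<le> T" "h0 \<le> 1" using assms K by (auto simp: h0_def)
    have "K * h0 < (K + 1) * h0" using \<open>h0 > 0\<close> by simp
    also have "\<dots> \<le> (K + 1) * (r / (K + 1))" using K by (intro mult_left_mono) (auto simp: h0_def)
    also have "\<dots> = r" using K by simp
    finally show "K * h0 < r" .
  qed
  obtain C where C: "C \<ge> 0" "\<And>(S :: real \<Rightarrow> 'a \<Rightarrow>\<^sub>L 'a) g D u u0 h \<zeta>.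
      mild_setting CF T r p ?M S g D u u0 h \<Longrightarrow> \<zeta> \<in> {0..1} \<Longrightarrow>
      norm (u (\<zeta> * h) - (S (\<zeta> * h) u0 + B_sum p S D h u0 \<zeta>)) \<le> C * h ^ Suc p"
    using B_series_error[of CF T r p ?M] by blast
  have "norm (u (\<zeta> * h) - (E A (\<zeta> * h) u0 + B_sum p (E A) D h u0 \<zeta>)) \<le> (C + 1) * h ^ (p + 1)"
    if E: "exp_family CF F E" "A \<in> F" and sol: "mild_solution T (E A) g u0 u"
      and D: "frechet_derivs p (tube T r u) g D" and M: "derivs_bounded p (tube T r u) M D"
      and h: "0 < h" "h \<le> h0" and \<zeta>: "0 \<le> \<zeta>" "\<zeta> \<le> 1"
    for F :: "('a \<rightharpoonup> 'a) set" and E A g D u u0 h \<zeta>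
  proof -
    have "mild_setting CF T r p ?M (E A) g D u u0 h"
    proof
      show "derivs_bounded p (tube T r u) ?M D"
        unfolding derivs_bounded_def
      proof (intro allI ballI impI)
        fix k w and vs :: "'a list"
        assume "k \<le> p" "w \<in> tube T r u" "length vs = k"
        then have "norm (D k w vs) \<le> M k * prod_list (map norm vs)"
          using M by (auto simp: derivs_bounded_def)
        also have "\<dots> \<le> \<bar>M k\<bar> * prod_list (map norm vs)"
          by (intro mult_right_mono prod_list_norm_nonneg) auto
        finally show "norm (D k w vs) \<le> \<bar>M k\<bar> * prod_list (map norm vs)" .
      qed
      have "CF * \<bar>M 0\<bar> * h \<le> K * h"
        using h unfolding K_def by (intro mult_right_mono) auto
      also have "\<dots> \<le> K * h0" using K h by (intro mult_left_mono)
      finally show "CF * \<bar>M 0\<bar> * h < r" using h0 by simp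
    qed (use exp_familyD[OF E] sol D h h0 in auto)
    then have "norm (u (\<zeta> * h) - (E A (\<zeta> * h) u0 + B_sum p (E A) D h u0 \<zeta>)) \<le> C * h ^ (p + 1)"
      using C(2)[of "E A" g D u u0 h \<zeta>] \<zeta> by simp
    also have "\<dots> \<le> (C + 1) * h ^ (p + 1)" using h by (intro mult_right_mono) auto
    finally show ?thesis .
  qed
  then show ?thesis using C(1) h0(1,2) by (intro exI[of _ "C + 1"] exI[of _ h0] conjI) auto
qed

end
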